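(* Let $q\in(1,\infty)$, let $A:\ell^q(\mathbb N)\to\ell^2(\mathbb N)$ be the diagonal operator $Ae_n=\lambda_ne_n$ and $\mathcal R=\frac1q\|\cdot\|_{\ell^q}^q$. Let $x^\dagger$ satisfy the source condition: there is $w\in\ell^2(\mathbb N)$ with $\xi:=A^*w\in\partial\mathcal R(x^\dagger)$. For noisy data $y^\delta$ with $\|y^\delta-y\|\le\delta$, let $\alpha_*=\alpha_*(y^\delta)$ be selected by the heuristic discrepancy rule, i.e. $\alpha_*\in\operatorname{argmin}_{\alpha\in(0,\alpha_{\max})}\frac1\alpha\|y^\delta-Ax^\delta_\alpha\|^2$, and suppose $\delta^*:=\|Ax^\delta_{\alpha_*}-y^\delta\|\ne0$. Suppose that there are constants $C_1,C_2>0$ such that for all noisy data $y^\delta$ and all $\alpha\in(0,\alpha_{\max})$, with $m_n:=\max\{|y_n|,|y^\delta_n|\}$, $$\sum_{\{n:\ \frac{\lambda_n^q}{\alpha}m_n^{2-q}\ge C_1\}}|y_n-y_n^\delta|^2\,m_n^{q-2}\,\frac{\alpha}{\lambda_n^q}\ \le\ C_2\sum_{\{n:\ \frac{\lambda_n^q}{\alpha}m_n^{2-q}<C_1\}}|y_n-y_n^\delta|^2 .$$ Then $$D_\xi(x^\delta_{\alpha_*},x^\dagger)\to0\qquad\text{as }\delta\to0.$$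
   Context: $\{e_n\}_{n\in\mathbb N}$ is the standard basis, and $\{\lambda_n\}$ is a sequence of real numbers, $\lambda_n>0$, monotonically decaying to $0$, such that $A$ is a continuous linear operator from $X=\ell^q(\mathbb N)$ to $Y=\ell^2(\mathbb N)$; $A^*$ is its adjoint $Y\to X^*$. $\alpha_{\max}>0$ is fixed. $y=\{y_n\}\in Y$ is exact data, $y^\delta=\{y_n^\delta\}\in Y$ noisy data given for each $\delta>0$, and $x^\dagger\in X$ is an $\mathcal R$-minimising solution: $Ax^\dagger=y$ and $\mathcal R(x^\dagger)=\min\{\mathcal R(x):Ax=y\}$. For $\alpha\in(0,\alpha_{\max})$, $x^\delta_\alpha$ is the minimiser over $x\in X$ of $\frac12\|Ax-y^\delta\|^2+\alpha\mathcal R(x)$. The Bregman distance is $D_\xi(x,x^\dagger)=\mathcal R(x)-\mathcal R(x^\dagger)-\langle\xi,x-x^\dagger\rangle_{X^*\times X}$. Terms in the sums with $y_n=y_n^\delta=0$ are read as $0$. *)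

theory Defs
  imports "HOL-Analysis.Analysis"
begin

text \<open>
  The exponent of a sequence space is a real parameter, so the spaces \<open>\<ell>\<^sup>p\<close> are carrier sets of
  real sequences, and the vector space operations are written pointwise.
\<close>

definition lp :: "real \<Rightarrow> (nat \<Rightarrow> real) set" where
  "lp p = {x. summable (\<lambda>n. \<bar>x n\<bar> powr p)}"

definition lp_norm :: "real \<Rightarrow> (nat \<Rightarrow> real) \<Rightarrow> real" where
  "lp_norm p x = (\<Sum>n. \<bar>x n\<bar> powr p) powr (1 / p)"

definition l2_inner :: "(nat \<Rightarrow> real) \<Rightarrow> (nat \<Rightarrow> real) \<Rightarrow> real" where
  "l2_inner u v = (\<Sum>n. u n * v n)"

definition unit_seq :: "nat \<Rightarrow> nat \<Rightarrow> real" where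
  "unit_seq n = (\<lambda>k. if k = n then 1 else 0)"

text \<open>Continuity of linear maps is expressed, as usual, by boundedness.\<close>

definition lp_bounded_linear ::
    "real \<Rightarrow> real \<Rightarrow> ((nat \<Rightarrow> real) \<Rightarrow> (nat \<Rightarrow> real)) \<Rightarrow> bool" where
  "lp_bounded_linear p r A \<longleftrightarrow>
     (\<forall>x\<in>lp p. A x \<in> lp r) \<and>
     (\<forall>x\<in>lp p. \<forall>z\<in>lp p. A (\<lambda>n. x n + z n) = (\<lambda>n. A x n + A z n)) \<and>
     (\<forall>c. \<forall>x\<in>lp p. A (\<lambda>n. c * x n) = (\<lambda>n. c * A x n)) \<and>
     (\<exists>K. \<forall>x\<in>lp p. lp_norm r (A x) \<le> K * lp_norm p x)"

text \<open>
  Elements of the dual space are functionals on sequences, of which only the values on \<open>lp p\<close>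
  matter; the duality pairing is function application.
\<close>

definition lp_dual :: "real \<Rightarrow> ((nat \<Rightarrow> real) \<Rightarrow> real) set" where
  "lp_dual p = {\<xi>.
     (\<forall>x\<in>lp p. \<forall>z\<in>lp p. \<xi> (\<lambda>n. x n + z n) = \<xi> x + \<xi> z) \<and>
     (\<forall>c. \<forall>x\<in>lp p. \<xi> (\<lambda>n. c * x n) = c * \<xi> x) \<and>
     (\<exists>K. \<forall>x\<in>lp p. \<bar>\<xi> x\<bar> \<le> K * lp_norm p x)}"

text \<open>
  The adjoint \<open>Y \<rightarrow> X\<^sup>*\<close> of an operator into the Hilbert space \<open>Y = \<ell>\<^sup>2\<close>, with \<open>Y\<^sup>*\<close> identified
  with \<open>Y\<close>.
\<close>

definition l2_adjoint ::
    "((nat \<Rightarrow> real) \<Rightarrow> (nat \<Rightarrow> real)) \<Rightarrow> (nat \<Rightarrow> real) \<Rightarrow> ((nat \<Rightarrow> real) \<Rightarrow> real)" where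
  "l2_adjoint A w = (\<lambda>x. l2_inner w (A x))"

definition lp_subdifferential ::
    "real \<Rightarrow> ((nat \<Rightarrow> real) \<Rightarrow> real) \<Rightarrow> (nat \<Rightarrow> real) \<Rightarrow> ((nat \<Rightarrow> real) \<Rightarrow> real) set" where
  "lp_subdifferential p F x =
     {\<xi> \<in> lp_dual p. \<forall>z\<in>lp p. F z \<ge> F x + \<xi> (\<lambda>n. z n - x n)}"

definition bregman_distance ::
    "((nat \<Rightarrow> real) \<Rightarrow> real) \<Rightarrow> ((nat \<Rightarrow> real) \<Rightarrow> real) \<Rightarrow>
     (nat \<Rightarrow> real) \<Rightarrow> (nat \<Rightarrow> real) \<Rightarrow> real" where
  "bregman_distance F \<xi> z x = F z - F x - \<xi> (\<lambda>n. z n - x n)"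

definition lq_penalty :: "real \<Rightarrow> (nat \<Rightarrow> real) \<Rightarrow> real" where
  "lq_penalty q x = 1 / q * lp_norm q x powr q"

definition residual_norm ::
    "((nat \<Rightarrow> real) \<Rightarrow> (nat \<Rightarrow> real)) \<Rightarrow> (nat \<Rightarrow> real) \<Rightarrow> (nat \<Rightarrow> real) \<Rightarrow> real" where
  "residual_norm A x z = lp_norm 2 (\<lambda>n. A x n - z n)"

definition tikhonov ::
    "real \<Rightarrow> ((nat \<Rightarrow> real) \<Rightarrow> (nat \<Rightarrow> real)) \<Rightarrow> (nat \<Rightarrow> real) \<Rightarrow> real \<Rightarrow> (nat \<Rightarrow> real) \<Rightarrow> real" where
  "tikhonov q A z \<alpha> x = 1 / 2 * (residual_norm A x z)\<^sup>2 + \<alpha> * lq_penalty q x"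

definition data_max :: "(nat \<Rightarrow> real) \<Rightarrow> (nat \<Rightarrow> real) \<Rightarrow> nat \<Rightarrow> real" where
  "data_max y z n = max \<bar>y n\<bar> \<bar>z n\<bar>"

text \<open>
  \<open>large_indices\<close> is the set of \<open>n\<close> with \<open>\<lambda>\<^sub>n\<^sup>q / \<alpha> * m\<^sub>n\<^sup>2\<^sup>-\<^sup>q \<ge> C\<close>. An index with \<open>y n = z n = 0\<close>
  contributes \<open>0\<close> to either sum in the condition below, whichever index set it belongs to. Both
  families are summable for \<open>y, z\<close> in \<open>\<ell>\<^sup>2\<close> and \<open>C\<^sub>1 > 0\<close>, because the weight in the sum on the left
  is at most \<open>1 / C\<^sub>1\<close> there, so the default value of a divergent \<open>infsum\<close> never occurs.
\<close>

definition large_indices ::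
    "real \<Rightarrow> (nat \<Rightarrow> real) \<Rightarrow> (nat \<Rightarrow> real) \<Rightarrow> (nat \<Rightarrow> real) \<Rightarrow> real \<Rightarrow> real \<Rightarrow> nat set" where
  "large_indices q lam y z \<alpha> C = {n. (lam n powr q) / \<alpha> * data_max y z n powr (2 - q) \<ge> C}"

definition noise_condition ::
    "real \<Rightarrow> (nat \<Rightarrow> real) \<Rightarrow> (nat \<Rightarrow> real) \<Rightarrow> (nat \<Rightarrow> real) \<Rightarrow> real \<Rightarrow> real \<Rightarrow> real \<Rightarrow> bool" where
  "noise_condition q lam y z \<alpha> C1 C2 \<longleftrightarrow>
     (\<Sum>\<^sub>\<infinity>n\<in>large_indices q lam y z \<alpha> C1.
        \<bar>y n - z n\<bar>\<^sup>2 * data_max y z n powr (q - 2) * (\<alpha> / lam n powr q))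
     \<le> C2 * (\<Sum>\<^sub>\<infinity>n\<in>- large_indices q lam y z \<alpha> C1. \<bar>y n - z n\<bar>\<^sup>2)"

end

theory Submission
  imports Defs
begin

text \<open>
  The problem splits into scalar ones. With \<open>\<beta> = \<alpha> / \<lambda>\<^sub>n\<^sup>q\<close> and \<open>t = \<lambda>\<^sub>n x\<^sub>n\<close>, the minimiser for
  data \<open>z\<close> solves \<open>t + \<beta> |t|\<^sup>q\<^sup>-\<^sup>1 sgn t = z\<^sub>n\<close>, with residual \<open>p\<^sub>n = \<beta> |t|\<^sup>q\<^sup>-\<^sup>1 sgn t\<close>, and the
  map from data to residual is nonexpansive. Let \<open>p\<close> and \<open>p\<^sub>0\<close> be the residuals for noisy and exact
  data and \<open>e\<close> the noise. The source condition gives \<open>|p\<^sub>0| \<le> \<alpha> |w|\<close>, and convexity bounds the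
  Bregman distance by \<open>\<Sum> |p - p\<^sub>0| |e| / \<alpha> + 2 \<Sum> |w| |e| + \<Sum> |w| |p|\<close>.

  On the large indices \<open>|p - p\<^sub>0| \<le> K \<beta> m\<^sup>q\<^sup>-\<^sup>2 |e|\<close>, so the noise condition moves this part of the
  first sum to the small indices, where \<open>e\<^sup>2 \<le> L (p\<^sup>2 + p\<^sub>0\<^sup>2)\<close>. Everything is thereby controlled by
  \<open>\<psi> = \<parallel>p\<parallel>\<^sup>2 / \<alpha>\<close> and \<open>\<parallel>p\<^sub>0\<parallel>\<^sup>2 / \<alpha>\<close>. Comparing \<open>\<alpha>\<^sub>*\<close> with the choice \<open>\<alpha> = \<delta>\<close> in the heuristic rule
  shows \<open>\<psi> = O(\<delta>)\<close>; and \<open>\<parallel>p\<^sub>0\<parallel>\<^sup>2 / \<alpha>\<close> is at most \<open>\<alpha> \<parallel>w\<parallel>\<^sup>2\<close>, which suffices if \<open>\<alpha> \<le> \<delta>\<close>, and at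
  most \<open>2 \<psi> + 2 \<delta>\<^sup>2 / \<alpha>\<close> by nonexpansiveness, which suffices otherwise.
\<close>

section \<open>Signed powers\<close>

text \<open>For s > 0 this is the derivative of |x|^(s+1) / (s+1); s = q - 1 gives the derivative of
  the scalar penalty |x|^q / q.\<close>

definition signed_powr :: "real \<Rightarrow> real \<Rightarrow> real" where
  "signed_powr s x = sgn x * \<bar>x\<bar> powr s"

lemma signed_powr_0 [simp]: "signed_powr s 0 = 0"
  by (simp add: signed_powr_def)

lemma signed_powr_minus [simp]: "signed_powr s (- x) = - signed_powr s x"
  by (simp add: signed_powr_def sgn_minus)

lemma signed_powr_nonneg: "0 \<le> x \<Longrightarrow> signed_powr s x = x powr s"
  by (cases "x = 0") (auto simp: signed_powr_def)

lemma abs_signed_powr: "\<bar>signed_powr s x\<bar> = \<bar>x\<bar> powr s"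
  by (simp add: signed_powr_def abs_mult abs_sgn_eq)

lemma signed_powr_mult_pos: "0 < c \<Longrightarrow> signed_powr s (c * x) = c powr s * signed_powr s x"
  by (simp add: signed_powr_def sgn_mult abs_mult powr_mult)

lemma signed_powr_mult_self: "signed_powr (q - 1) x * x = \<bar>x\<bar> powr q"
proof (cases "x = 0")
  case False
  have "\<bar>x\<bar> powr q = \<bar>x\<bar> powr (q - 1) * \<bar>x\<bar>"
    using False by (simp add: powr_diff)
  then show ?thesis
    by (simp add: signed_powr_def abs_sgn mult.assoc mult.left_commute)
qed simp

text \<open>A form free of \<open>sgn\<close>: continuity and monotonicity for s > 0 can be read off
  from the two one-sided powers.\<close>

lemma signed_powr_eq_max:
  "signed_powr s x = max x 0 powr s - max (- x) 0 powr s"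
  by (cases "0 \<le> x") (auto simp: signed_powr_def max_def sgn_if)

lemma continuous_on_signed_powr [continuous_intros]:
  assumes "continuous_on S f" "0 < s"
  shows "continuous_on S (\<lambda>x. signed_powr s (f x))"
  unfolding signed_powr_eq_max using assms
  by (intro continuous_intros continuous_on_powr') auto

lemma signed_powr_mono:
  assumes "0 < s"
  shows "mono (signed_powr s)"
proof
  fix x y :: real
  assume "x \<le> y"
  then have "max x 0 powr s \<le> max y 0 powr s" "max (- y) 0 powr s \<le> max (- x) 0 powr s"
    using assms by (auto intro!: powr_mono2)
  then show "signed_powr s x \<le> signed_powr s y"
    unfolding signed_powr_eq_max by linarith
qed

text \<open>Convexity of |x|^q / q without differentiation: Young's inequality with exponents q / (q
  - 1) and q bounds the product with b, and \<open>signed_powr_mult_self\<close> evaluates the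
  product with a.\<close>

lemma abs_powr_subgradient:
  assumes "1 < q"
  shows "\<bar>a\<bar> powr q / q + signed_powr (q - 1) a * (b - a) \<le> \<bar>b\<bar> powr q / q"
proof -
  define r where "r = q / (q - 1)"
  have r: "1 < r" "1 / r + 1 / q = 1" "(q - 1) * r = q" "1 / r = 1 - 1 / q"
    using assms by (auto simp: r_def field_simps)
  have "signed_powr (q - 1) a * b \<le> \<bar>a\<bar> powr (q - 1) * \<bar>b\<bar>"
    by (metis abs_ge_self abs_mult abs_signed_powr)
  also have "\<dots> \<le> (\<bar>a\<bar> powr (q - 1)) powr r / r + \<bar>b\<bar> powr q / q"
    by (rule Youngs_inequality) (use assms r in auto)
  also have "(\<bar>a\<bar> powr (q - 1)) powr r / r = \<bar>a\<bar> powr q * (1 - 1 / q)"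
    using r by (simp add: powr_powr divide_inverse)
  finally show ?thesis
    using signed_powr_mult_self[of q a] by (simp add: right_diff_distrib algebra_simps)
qed

text \<open>A mean value estimate that uses the power s - 1 of the larger argument only, so it
  survives s < 1, where the derivative blows up at 0. The constant s + 2 covers three cases: for b
  \<ge> 0 it suffices to have 1 if s \<le> 1 and s if s > 1; for b < 0 it suffices to have
  2.\<close>

lemma signed_powr_diff_le_nonneg:
  assumes "0 < s" "\<bar>b\<bar> \<le> a"
  shows "\<bar>signed_powr s a - signed_powr s b\<bar> \<le> (s + 2) * (a - b) * a powr (s - 1)"
proof (cases "a = 0")
  case False
  with assms have a: "0 < a" by linarith
  have as: "a powr s = a powr (s - 1) * a"
    using a by (simp add: powr_diff)
  have mono: "signed_powr s b \<le> signed_powr s a"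
    using assms signed_powr_mono[OF assms(1)] by (auto dest!: monoD[of _ b a])
  show ?thesis
  proof (cases "0 \<le> b")
    case b: True
    \<comment> \<open>Dividing by a^s leaves a one-variable inequality on [0, 1].\<close>
    define u where "u = b / a"
    have u: "0 \<le> u" "u \<le> 1" "b = a * u"
      using a b assms by (auto simp: u_def)
    have "1 - u powr s \<le> (s + 2) * (1 - u)"
    proof (cases "s \<le> 1")
      case True
      have "u \<le> u powr s"
        using powr_mono'[of s 1 u] True u by simp
      moreover have "1 * (1 - u) \<le> (s + 2) * (1 - u)"
        using u assms by (intro mult_right_mono) auto
      ultimately show ?thesis
        by (metis diff_left_mono mult_1 order_trans)
    next
      case False
      then have "1 / (s / (s - 1)) = 1 - 1 / s"
        by (simp add: field_simps)
      \<comment> \<open>Young's inequality with second factor 1 yields the Bernoulli inequality 1 -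
        u^s \<le> s (1 - u).\<close>
      then have "u * 1 \<le> u powr s / s + (1 - 1 / s)"
        using Youngs_inequality[of s "s / (s - 1)" u 1] False u
        by (simp add: field_simps)
      then have "s * (u * 1) \<le> s * (u powr s / s + (1 - 1 / s))"
        using assms by (intro mult_left_mono) auto
      also have "\<dots> = u powr s + (s - 1)"
        using False by (simp add: field_simps)
      finally have "1 - u powr s \<le> s * (1 - u)"
        by (simp add: right_diff_distrib)
      also have "\<dots> \<le> (s + 2) * (1 - u)"
        using u by (intro mult_right_mono) auto
      finally show ?thesis .
    qed
    then have "a powr s * (1 - u powr s) \<le> a powr s * ((s + 2) * (1 - u))"
      by (intro mult_left_mono) auto
    also have "\<dots> = (s + 2) * (a - b) * a powr (s - 1)"
      by (simp add: u as algebra_simps)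
    finally show ?thesis
      using mono a b u by (simp add: signed_powr_nonneg powr_mult algebra_simps)
  next
    case b: False
    \<comment> \<open>With opposite signs a \<le> a - b, so bounding each power by a^s loses only a
      constant.\<close>
    have "\<bar>signed_powr s a - signed_powr s b\<bar> \<le> a powr s + \<bar>b\<bar> powr s"
      using abs_triangle_ineq4[of "signed_powr s a" "signed_powr s b"] a
      by (simp add: abs_signed_powr)
    also have "\<dots> \<le> 2 * a powr s"
      using assms powr_mono2[of s "\<bar>b\<bar>" a] by simp
    also have "\<dots> = 2 * a * a powr (s - 1)"
      by (simp add: as)
    also have "\<dots> \<le> (s + 2) * (a - b) * a powr (s - 1)"
      using assms a b by (intro mult_right_mono mult_mono) auto
    finally show ?thesis .
  qed
qed (use assms in auto)

lemma signed_powr_diff_le: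
  assumes "0 < s"
  shows "\<bar>signed_powr s a - signed_powr s b\<bar>
         \<le> (s + 2) * \<bar>a - b\<bar> * max \<bar>a\<bar> \<bar>b\<bar> powr (s - 1)"
proof -
  have main: "\<bar>signed_powr s a - signed_powr s b\<bar> \<le> (s + 2) * \<bar>a - b\<bar> * \<bar>a\<bar> powr (s - 1)"
    if "\<bar>b\<bar> \<le> \<bar>a\<bar>" for a b
  proof (cases "0 \<le> a")
    case True
    then show ?thesis
      using signed_powr_diff_le_nonneg[OF assms, of b a] that by simp
  next
    case False
    then show ?thesis
      using signed_powr_diff_le_nonneg[OF assms, of "- b" "- a"] that
      by (simp add: abs_minus_commute)
  qed
  show ?thesis
    using main[of b a] main[of a b]
    by (cases "\<bar>b\<bar> \<le> \<bar>a\<bar>") (auto simp: max_def abs_minus_commute)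
qed

section \<open>Stationarity in one variable\<close>

lemma eq_0_if_mult_nonneg:
  fixes g :: "real \<Rightarrow> real"
  assumes "isCont g 0" "\<And>h. 0 \<le> g h * h"
  shows "g 0 = 0"
proof (rule antisym)
  have "g h \<le> 0" if "h < 0" for h
    using assms(2)[of h] that by (simp add: zero_le_mult_iff)
  then have "eventually (\<lambda>h. g h \<le> 0) (at_left 0)"
    by (auto simp: eventually_at_filter)
  moreover have "(g \<longlongrightarrow> g 0) (at_left 0)"
    using assms(1) by (auto simp: isCont_def intro: tendsto_within_subset)
  ultimately show "g 0 \<le> 0"
    by (intro tendsto_upperbound) auto
  have "0 \<le> g h" if "0 < h" for h
    using assms(2)[of h] that by (simp add: zero_le_mult_iff)
  then have "eventually (\<lambda>h. 0 \<le> g h) (at_right 0)"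
    by (auto simp: eventually_at_filter)
  moreover have "(g \<longlongrightarrow> g 0) (at_right 0)"
    using assms(1) by (auto simp: isCont_def intro: tendsto_within_subset)
  ultimately show "0 \<le> g 0"
    by (intro tendsto_lowerbound) auto
qed

text \<open>Serves both optimality conditions below: b is the coefficient of the quadratic data term
  for the Tikhonov functional, and 0 for the subdifferential. The minimum property says that the
  continuous function \<open>g\<close> satisfies g(h) h \<ge> 0, which forces g(0) = 0.\<close>

lemma abs_powr_stationary:
  assumes q: "1 < q" and \<alpha>: "0 < \<alpha>"
    and min: "\<And>h. a * h + \<alpha> * (\<bar>x\<bar> powr q / q) \<le> b * h\<^sup>2 + \<alpha> * (\<bar>x + h\<bar> powr q / q)"
  shows "a = \<alpha> * signed_powr (q - 1) x"
proof -
  define g where "g h = b * h + \<alpha> * signed_powr (q - 1) (x + h) - a" for h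
  have "continuous_on UNIV g"
    unfolding g_def using q by (intro continuous_intros) auto
  then have "isCont g 0"
    by (simp add: continuous_on_eq_continuous_at)
  moreover have "0 \<le> g h * h" for h
  proof -
    \<comment> \<open>The subgradient is taken at the perturbed point x + h, so that the penalty
      increment is bounded from above.\<close>
    have "\<bar>x + h\<bar> powr q / q - \<bar>x\<bar> powr q / q \<le> signed_powr (q - 1) (x + h) * h"
      using abs_powr_subgradient[OF q, of "x + h" x] by simp
    then have "\<alpha> * (\<bar>x + h\<bar> powr q / q - \<bar>x\<bar> powr q / q)
               \<le> \<alpha> * (signed_powr (q - 1) (x + h) * h)"
      using \<alpha> by (intro mult_left_mono) auto
    then show ?thesis
      using min[of h] by (simp add: g_def algebra_simps power2_eq_square)
  qed
  ultimately have "g 0 = 0"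
    by (rule eq_0_if_mult_nonneg)
  then show ?thesis
    by (simp add: g_def)
qed

section \<open>The scalar equation t + \<beta> |t|^s sgn t = y\<close>

lemma scalar_equation_solvable:
  assumes "0 < s" "0 \<le> \<beta>"
  shows "\<exists>t. t + \<beta> * signed_powr s t = y"
proof -
  have pos: "\<exists>t. t + \<beta> * signed_powr s t = y" if "0 \<le> y" for y
  proof -
    have "continuous_on {0..y} (\<lambda>t. t + \<beta> * signed_powr s t)"
      using assms by (intro continuous_intros) auto
    then show ?thesis
      using IVT'[of "\<lambda>t. t + \<beta> * signed_powr s t" 0 y y] that assms
      by (auto simp: signed_powr_nonneg)
  qed
  show ?thesis
  proof (cases "0 \<le> y")
    case False
    then obtain t where "t + \<beta> * signed_powr s t = - y"
      using pos[of "- y"] by auto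
    then show ?thesis
      by (intro exI[of _ "- t"]) simp
  qed (use pos in auto)
qed

text \<open>By monotonicity the increments of t and of the residual have the same sign; they add up
  to z - y, so neither exceeds it in modulus.\<close>

lemma scalar_residual_nonexpansive:
  assumes "0 < s" "0 \<le> \<beta>"
    and t: "t + \<beta> * signed_powr s t = z" and t0: "t0 + \<beta> * signed_powr s t0 = y"
  shows "\<bar>t - t0\<bar> \<le> \<bar>z - y\<bar>"
    and "\<bar>\<beta> * signed_powr s t - \<beta> * signed_powr s t0\<bar> \<le> \<bar>z - y\<bar>"
proof -
  have eq: "z - y = (t - t0) + (\<beta> * signed_powr s t - \<beta> * signed_powr s t0)"
    using t t0 by simp
  have "\<beta> * signed_powr s t \<le> \<beta> * signed_powr s t0" if "t \<le> t0"
    using that assms signed_powr_mono by (intro mult_left_mono) (auto dest: monoD)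
  moreover have "\<beta> * signed_powr s t0 \<le> \<beta> * signed_powr s t" if "t0 \<le> t"
    using that assms signed_powr_mono by (intro mult_left_mono) (auto dest: monoD)
  ultimately show "\<bar>t - t0\<bar> \<le> \<bar>z - y\<bar>"
    "\<bar>\<beta> * signed_powr s t - \<beta> * signed_powr s t0\<bar> \<le> \<bar>z - y\<bar>"
    unfolding eq by (cases "t \<le> t0"; simp)+
qed

text \<open>Both summands carry the sign of t, so no cancellation occurs.\<close>

lemma abs_scalar_equation:
  assumes "0 \<le> \<beta>" "t + \<beta> * signed_powr s t = z"
  shows "\<bar>t\<bar> + \<beta> * \<bar>t\<bar> powr s = \<bar>z\<bar>"
proof (cases "0 \<le> t")
  case True
  then show ?thesis
    using assms by (auto simp: signed_powr_nonneg)
next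
  case False
  then have "- t + \<beta> * (- t) powr s = - z"
    using assms(2) by (simp add: signed_powr_def algebra_simps)
  moreover have "0 \<le> \<beta> * (- t) powr s"
    using assms by simp
  ultimately show ?thesis
    using False by simp
qed

section \<open>Residuals of the scalar problems\<close>

text \<open>If |t| < |z| / 2, the residual \<beta> |t|^s carries at least half of |z|, and the
  largeness hypothesis bounds |z| / 2 below by (C / 2) \<beta> |z|^s; dividing by \<beta> and taking
  roots compares |t| with |z|. For s = q - 1 and \<beta> = \<alpha> / \<lambda>^q the hypothesis is
  membership in \<open>large_indices\<close>.\<close>

lemma scalar_solution_lower_bound:
  assumes "0 < s" "0 < \<beta>" "0 < C" "z \<noteq> 0" and large: "C * \<beta> \<le> \<bar>z\<bar> powr (1 - s)"
    and t: "t + \<beta> * signed_powr s t = z"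
  shows "min (1 / 2) ((C / 2) powr (1 / s)) * \<bar>z\<bar> \<le> \<bar>t\<bar>"
proof (cases "\<bar>z\<bar> / 2 \<le> \<bar>t\<bar>")
  case True
  have "min (1 / 2) ((C / 2) powr (1 / s)) * \<bar>z\<bar> \<le> 1 / 2 * \<bar>z\<bar>"
    by (rule mult_right_mono[OF min.cobounded1]) simp
  with True show ?thesis by linarith
next
  case False
  then have "\<bar>z\<bar> / 2 \<le> \<beta> * \<bar>t\<bar> powr s"
    using abs_scalar_equation[OF _ t] assms by linarith
  moreover have "C * \<beta> * \<bar>z\<bar> powr s \<le> \<bar>z\<bar>"
    using mult_right_mono[OF large, of "\<bar>z\<bar> powr s"] assms by (simp flip: powr_add)
  ultimately have "\<beta> * (C / 2 * \<bar>z\<bar> powr s) \<le> \<beta> * \<bar>t\<bar> powr s"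
    by (simp add: mult_ac)
  then have "(C / 2 * \<bar>z\<bar> powr s) powr (1 / s) \<le> (\<bar>t\<bar> powr s) powr (1 / s)"
    using assms by (intro powr_mono2) auto
  then have "(C / 2) powr (1 / s) * \<bar>z\<bar> \<le> \<bar>t\<bar>"
    unfolding powr_mult powr_powr using assms by simp
  moreover have "min (1 / 2) ((C / 2) powr (1 / s)) * \<bar>z\<bar> \<le> (C / 2) powr (1 / s) * \<bar>z\<bar>"
    by (rule mult_right_mono[OF min.cobounded2]) simp
  ultimately show ?thesis by linarith
qed

text \<open>The larger solution modulus M is comparable to the larger datum m, namely c m \<le> M
  \<le> m, so M^(s-1) in \<open>signed_powr_diff_le\<close> can be traded for m^(s-1). K depends on
  s and C only.\<close>

lemma residual_lipschitz_large:
  assumes "0 < s" "0 < C"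
  obtains K where "0 \<le> K"
    "\<And>\<beta> y z t t0. \<lbrakk>0 < \<beta>; C * \<beta> \<le> max \<bar>y\<bar> \<bar>z\<bar> powr (1 - s);
       t + \<beta> * signed_powr s t = z; t0 + \<beta> * signed_powr s t0 = y\<rbrakk> \<Longrightarrow>
       \<bar>\<beta> * signed_powr s t - \<beta> * signed_powr s t0\<bar>
         \<le> K * (\<beta> * max \<bar>y\<bar> \<bar>z\<bar> powr (s - 1) * \<bar>z - y\<bar>)"
proof -
  define c where "c = min (1 / 2) ((C / 2) powr (1 / s))"
  define K where "K = (s + 2) * max 1 (c powr (s - 1))"
  have c: "0 < c"
    using assms by (simp add: c_def)
  show thesis
  proof (rule that[of K])
    show "0 \<le> K"
      using assms by (simp add: K_def)
    fix \<beta> y z t t0 :: real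
    define m where "m = max \<bar>y\<bar> \<bar>z\<bar>"
    define M where "M = max \<bar>t\<bar> \<bar>t0\<bar>"
    assume \<beta>: "0 < \<beta>" and large: "C * \<beta> \<le> max \<bar>y\<bar> \<bar>z\<bar> powr (1 - s)"
      and t: "t + \<beta> * signed_powr s t = z" and t0: "t0 + \<beta> * signed_powr s t0 = y"
    \<comment> \<open>Since \<open>0 powr _ = 0\<close>, largeness excludes m = 0.\<close>
    have "0 < C * \<beta>"
      using \<beta> assms by simp
    then have "0 < m powr (1 - s)"
      using large unfolding m_def by linarith
    then have "m \<noteq> 0"
      by auto
    moreover have "0 \<le> m"
      by (simp add: m_def)
    ultimately have m: "0 < m"
      by simp
    have "\<bar>t\<bar> + \<beta> * \<bar>t\<bar> powr s = \<bar>z\<bar>" "\<bar>t0\<bar> + \<beta> * \<bar>t0\<bar> powr s = \<bar>y\<bar>"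
      by (rule abs_scalar_equation[OF less_imp_le[OF \<beta>] t]
            abs_scalar_equation[OF less_imp_le[OF \<beta>] t0])+
    moreover have "0 \<le> \<beta> * \<bar>u\<bar> powr s" for u
      using \<beta> by simp
    note this[of t] this[of t0]
    ultimately have M_le: "M \<le> m"
      unfolding M_def m_def by linarith
    \<comment> \<open>The hypothesis concerns only the larger of the two data; its own solution
      already gives the bound.\<close>
    have M_ge: "c * m \<le> M"
    proof (cases "\<bar>y\<bar> \<le> \<bar>z\<bar>")
      case True
      then have m_eq: "m = \<bar>z\<bar>"
        by (simp add: m_def)
      have "c * \<bar>z\<bar> \<le> \<bar>t\<bar>"
        unfolding c_def
      proof (rule scalar_solution_lower_bound[OF assms(1) \<beta> assms(2) _ _ t])
        show "z \<noteq> 0"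
          using m m_eq by simp
        show "C * \<beta> \<le> \<bar>z\<bar> powr (1 - s)"
          using large by (simp only: m_def[symmetric] m_eq)
      qed
      then show ?thesis
        unfolding m_eq M_def by linarith
    next
      case False
      then have m_eq: "m = \<bar>y\<bar>"
        by (simp add: m_def)
      have "c * \<bar>y\<bar> \<le> \<bar>t0\<bar>"
        unfolding c_def
      proof (rule scalar_solution_lower_bound[OF assms(1) \<beta> assms(2) _ _ t0])
        show "y \<noteq> 0"
          using m m_eq by simp
        show "C * \<beta> \<le> \<bar>y\<bar> powr (1 - s)"
          using large by (simp only: m_def[symmetric] m_eq)
      qed
      then show ?thesis
        unfolding m_eq M_def by linarith
    qed
    \<comment> \<open>The exponent s - 1 changes sign at s = 1: M \<le> m is used above it, c m
      \<le> M below it.\<close>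
    have "M powr (s - 1) \<le> max 1 (c powr (s - 1)) * m powr (s - 1)"
    proof (cases "1 \<le> s")
      case True
      then have "M powr (s - 1) \<le> 1 * m powr (s - 1)"
        using M_le by (auto intro: powr_mono2 simp: M_def)
      also have "\<dots> \<le> max 1 (c powr (s - 1)) * m powr (s - 1)"
        by (intro mult_right_mono) auto
      finally show ?thesis .
    next
      case False
      then have "M powr (s - 1) \<le> (c * m) powr (s - 1)"
        using M_ge c m by (intro powr_mono2') auto
      also have "\<dots> = c powr (s - 1) * m powr (s - 1)"
        by (simp add: powr_mult)
      also have "\<dots> \<le> max 1 (c powr (s - 1)) * m powr (s - 1)"
        by (intro mult_right_mono) auto
      finally show ?thesis .
    qed
    moreover have "\<bar>t - t0\<bar> \<le> \<bar>z - y\<bar>"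
      using scalar_residual_nonexpansive(1)[OF assms(1) _ t t0] \<beta> by simp
    ultimately have "(s + 2) * \<bar>t - t0\<bar> * M powr (s - 1)
        \<le> (s + 2) * \<bar>z - y\<bar> * (max 1 (c powr (s - 1)) * m powr (s - 1))"
      using assms by (intro mult_mono) auto
    also have "\<dots> = K * (m powr (s - 1) * \<bar>z - y\<bar>)"
      by (simp add: K_def)
    finally have "\<bar>signed_powr s t - signed_powr s t0\<bar> \<le> K * (m powr (s - 1) * \<bar>z - y\<bar>)"
      using signed_powr_diff_le[OF assms(1), of t t0] by (simp add: M_def)
    then have "\<beta> * \<bar>signed_powr s t - signed_powr s t0\<bar>
        \<le> \<beta> * (K * (m powr (s - 1) * \<bar>z - y\<bar>))"
      using \<beta> by (intro mult_left_mono) auto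
    moreover have "\<beta> * \<bar>signed_powr s t - signed_powr s t0\<bar>
        = \<bar>\<beta> * signed_powr s t - \<beta> * signed_powr s t0\<bar>"
      using \<beta> by (simp add: abs_mult flip: right_diff_distrib)
    ultimately show "\<bar>\<beta> * signed_powr s t - \<beta> * signed_powr s t0\<bar>
         \<le> K * (\<beta> * max \<bar>y\<bar> \<bar>z\<bar> powr (s - 1) * \<bar>z - y\<bar>)"
      by (simp add: m_def mult_ac)
  qed
qed

text \<open>The counterpart of \<open>scalar_solution_lower_bound\<close> with the roles exchanged:
  if the residual is below |z| / 2, then |t| \<ge> |z| / 2, and smallness, |z| \<le> C \<beta>
  |z|^s, turns \<beta> |t|^s into a multiple of |z|.\<close>

lemma scalar_residual_lower_bound:
  assumes "0 < s" "0 < \<beta>" "0 < C" "z \<noteq> 0" and small: "\<bar>z\<bar> powr (1 - s) < C * \<beta>"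
    and t: "t + \<beta> * signed_powr s t = z"
  shows "min (1 / 2) ((1 / 2) powr s / C) * \<bar>z\<bar> \<le> \<bar>\<beta> * signed_powr s t\<bar>"
proof -
  have p: "\<bar>\<beta> * signed_powr s t\<bar> = \<beta> * \<bar>t\<bar> powr s"
    using assms by (simp add: abs_mult abs_signed_powr)
  show ?thesis
  proof (cases "\<bar>z\<bar> / 2 \<le> \<beta> * \<bar>t\<bar> powr s")
    case True
    have "min (1 / 2) ((1 / 2) powr s / C) * \<bar>z\<bar> \<le> 1 / 2 * \<bar>z\<bar>"
      by (rule mult_right_mono[OF min.cobounded1]) simp
    with True p show ?thesis by linarith
  next
    case False
    then have t_ge: "1 / 2 * \<bar>z\<bar> \<le> \<bar>t\<bar>"
      using abs_scalar_equation[OF _ t] assms by linarith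
    have "\<bar>z\<bar> \<le> C * \<beta> * \<bar>z\<bar> powr s"
      using mult_right_mono[OF less_imp_le[OF small], of "\<bar>z\<bar> powr s"] assms
      by (simp flip: powr_add)
    then have "(1 / 2) powr s / C * \<bar>z\<bar> \<le> (1 / 2) powr s / C * (C * \<beta> * \<bar>z\<bar> powr s)"
      using assms by (intro mult_left_mono) auto
    also have "\<dots> = \<beta> * (1 / 2 * \<bar>z\<bar>) powr s"
      using assms by (simp only: powr_mult) simp
    also have "\<dots> \<le> \<beta> * \<bar>t\<bar> powr s"
      using t_ge assms by (intro mult_left_mono powr_mono2) auto
    finally have "(1 / 2) powr s / C * \<bar>z\<bar> \<le> \<beta> * \<bar>t\<bar> powr s" .
    moreover have "min (1 / 2) ((1 / 2) powr s / C) * \<bar>z\<bar> \<le> (1 / 2) powr s / C * \<bar>z\<bar>"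
      by (rule mult_right_mono[OF min.cobounded2]) simp
    ultimately show ?thesis
      using p by linarith
  qed
qed

text \<open>The noise is at most 2 m, while the residual belonging to the larger datum is at least d
  m; the quotient gives L = 4 / d^2.\<close>

lemma noise_le_residuals_small:
  assumes "0 < s" "0 < C"
  obtains L where "0 \<le> L"
    "\<And>\<beta> y z t t0. \<lbrakk>0 < \<beta>; max \<bar>y\<bar> \<bar>z\<bar> powr (1 - s) < C * \<beta>;
       t + \<beta> * signed_powr s t = z; t0 + \<beta> * signed_powr s t0 = y\<rbrakk> \<Longrightarrow>
       (z - y)\<^sup>2 \<le> L * ((\<beta> * signed_powr s t)\<^sup>2 + (\<beta> * signed_powr s t0)\<^sup>2)"
proof -
  define d where "d = min (1 / 2) ((1 / 2) powr s / C)"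
  have d: "0 < d"
    using assms by (simp add: d_def)
  show thesis
  proof (rule that[of "4 / d\<^sup>2"])
    fix \<beta> y z t t0 :: real
    define m where "m = max \<bar>y\<bar> \<bar>z\<bar>"
    define p where "p = \<beta> * signed_powr s t"
    define p0 where "p0 = \<beta> * signed_powr s t0"
    assume \<beta>: "0 < \<beta>" and small: "max \<bar>y\<bar> \<bar>z\<bar> powr (1 - s) < C * \<beta>"
      and t: "t + \<beta> * signed_powr s t = z" and t0: "t0 + \<beta> * signed_powr s t0 = y"
    have "(d * m)\<^sup>2 \<le> p\<^sup>2 + p0\<^sup>2"
    \<comment> \<open>Vanishing data count as small because \<open>0 powr _ = 0\<close>, but the
      lower bound requires a nonzero datum.\<close>
    proof (cases "m = 0")
      case m: False
      show ?thesis
      proof (cases "\<bar>y\<bar> \<le> \<bar>z\<bar>")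
        case True
        then have m_eq: "m = \<bar>z\<bar>"
          by (simp add: m_def)
        have "d * \<bar>z\<bar> \<le> \<bar>p\<bar>"
          unfolding d_def p_def
        proof (rule scalar_residual_lower_bound[OF assms(1) \<beta> assms(2) _ _ t])
          show "z \<noteq> 0"
            using m m_eq by simp
          show "\<bar>z\<bar> powr (1 - s) < C * \<beta>"
            using small by (simp only: m_def[symmetric] m_eq)
        qed
        then have "(d * m)\<^sup>2 \<le> \<bar>p\<bar>\<^sup>2"
          using d unfolding m_eq by (intro power_mono) auto
        then show ?thesis
          by (simp add: add_increasing2)
      next
        case False
        then have m_eq: "m = \<bar>y\<bar>"
          by (simp add: m_def)
        have "d * \<bar>y\<bar> \<le> \<bar>p0\<bar>"
          unfolding d_def p0_def
        proof (rule scalar_residual_lower_bound[OF assms(1) \<beta> assms(2) _ _ t0])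
          show "y \<noteq> 0"
            using m m_eq by simp
          show "\<bar>y\<bar> powr (1 - s) < C * \<beta>"
            using small by (simp only: m_def[symmetric] m_eq)
        qed
        then have "(d * m)\<^sup>2 \<le> \<bar>p0\<bar>\<^sup>2"
          using d unfolding m_eq by (intro power_mono) auto
        then show ?thesis
          by (simp add: add_increasing)
      qed
    qed auto
    then have "4 / d\<^sup>2 * (d * m)\<^sup>2 \<le> 4 / d\<^sup>2 * (p\<^sup>2 + p0\<^sup>2)"
      by (intro mult_left_mono) auto
    moreover have "\<bar>z - y\<bar> \<le> \<bar>2 * m\<bar>"
      unfolding m_def by linarith
    then have "(z - y)\<^sup>2 \<le> (2 * m)\<^sup>2"
      by (simp only: abs_le_square_iff)
    then have "(z - y)\<^sup>2 \<le> 4 / d\<^sup>2 * (d * m)\<^sup>2"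
      using d by (simp add: power_mult_distrib)
    ultimately show "(z - y)\<^sup>2 \<le> 4 / d\<^sup>2 * (p\<^sup>2 + p0\<^sup>2)"
      by linarith
  qed simp
qed

section \<open>Summation over the index sets\<close>

text \<open>Links the unordered sums of the noise condition to the ordered series of the norms;
  absolute convergence makes them agree.\<close>

lemma infsum_eq_suminf_indicator:
  fixes f :: "nat \<Rightarrow> real"
  assumes "summable (\<lambda>n. \<bar>if n \<in> S then f n else 0\<bar>)"
  shows "infsum f S = (\<Sum>n. if n \<in> S then f n else 0)"
proof -
  have "infsum f S = infsum (\<lambda>n. if n \<in> S then f n else 0) UNIV"
    by (rule infsum_cong_neutral) auto
  also have "((\<lambda>n. if n \<in> S then f n else 0) has_sum (\<Sum>n. if n \<in> S then f n else 0)) UNIV"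
    using assms by (intro norm_summable_imp_has_sum summable_sums)
      (auto intro: summable_rabs_cancel)
  then have "infsum (\<lambda>n. if n \<in> S then f n else 0) UNIV = (\<Sum>n. if n \<in> S then f n else 0)"
    by (rule infsumI)
  finally show ?thesis .
qed

text \<open>B is chosen before the operator, the parameter and the data, so it stays fixed as the
  noise level tends to 0. Nonexpansiveness treats the small indices, the Lipschitz estimate and the
  noise condition reduce the large ones to them.\<close>

lemma noise_condition_residual_bound:
  assumes q: "1 < q" and C1: "0 < C1" and C2: "0 < C2"
  obtains B where "0 \<le> B"
    "\<And>lam \<alpha> y z p p0. \<lbrakk>\<And>n. 0 < lam n; 0 < \<alpha>;
       summable (\<lambda>n. (z n - y n)\<^sup>2); summable (\<lambda>n. (p n)\<^sup>2); summable (\<lambda>n. (p0 n)\<^sup>2);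
       \<And>n. p n = \<alpha> / lam n powr q * signed_powr (q - 1) (z n - p n);
       \<And>n. p0 n = \<alpha> / lam n powr q * signed_powr (q - 1) (y n - p0 n);
       noise_condition q lam y z \<alpha> C1 C2\<rbrakk> \<Longrightarrow>
       summable (\<lambda>n. \<bar>p n - p0 n\<bar> * \<bar>z n - y n\<bar>) \<and>
       (\<Sum>n. \<bar>p n - p0 n\<bar> * \<bar>z n - y n\<bar>) \<le> B * ((\<Sum>n. (p n)\<^sup>2) + (\<Sum>n. (p0 n)\<^sup>2))"
proof -
  obtain K where K: "0 \<le> K" and large: "\<And>\<beta> y z t t0.
      \<lbrakk>0 < \<beta>; C1 * \<beta> \<le> max \<bar>y\<bar> \<bar>z\<bar> powr (1 - (q - 1));
       t + \<beta> * signed_powr (q - 1) t = z; t0 + \<beta> * signed_powr (q - 1) t0 = y\<rbrakk> \<Longrightarrow>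
       \<bar>\<beta> * signed_powr (q - 1) t - \<beta> * signed_powr (q - 1) t0\<bar>
         \<le> K * (\<beta> * max \<bar>y\<bar> \<bar>z\<bar> powr (q - 1 - 1) * \<bar>z - y\<bar>)"
    using residual_lipschitz_large[of "q - 1" C1] q C1 by auto
  obtain L where L: "0 \<le> L" and small: "\<And>\<beta> y z t t0.
      \<lbrakk>0 < \<beta>; max \<bar>y\<bar> \<bar>z\<bar> powr (1 - (q - 1)) < C1 * \<beta>;
       t + \<beta> * signed_powr (q - 1) t = z; t0 + \<beta> * signed_powr (q - 1) t0 = y\<rbrakk> \<Longrightarrow>
       (z - y)\<^sup>2 \<le> L * ((\<beta> * signed_powr (q - 1) t)\<^sup>2 + (\<beta> * signed_powr (q - 1) t0)\<^sup>2)"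
    using noise_le_residuals_small[of "q - 1" C1] q C1 by auto
  show thesis
  proof (rule that[of "(K * C2 + 1) * L"])
    show "0 \<le> (K * C2 + 1) * L"
      using K C2 L by simp
    fix lam y z p p0 :: "nat \<Rightarrow> real" and \<alpha> :: real
    assume lam: "\<And>n. 0 < lam n" and \<alpha>: "0 < \<alpha>"
      and se: "summable (\<lambda>n. (z n - y n)\<^sup>2)"
      and sp: "summable (\<lambda>n. (p n)\<^sup>2)" and sp0: "summable (\<lambda>n. (p0 n)\<^sup>2)"
      and p: "\<And>n. p n = \<alpha> / lam n powr q * signed_powr (q - 1) (z n - p n)"
      and p0: "\<And>n. p0 n = \<alpha> / lam n powr q * signed_powr (q - 1) (y n - p0 n)"
      and noise: "noise_condition q lam y z \<alpha> C1 C2"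
    define S where "S = large_indices q lam y z \<alpha> C1"
    define \<beta> where "\<beta> n = \<alpha> / lam n powr q" for n
    define m where "m = data_max y z"
    define g where "g = (\<lambda>n. \<bar>y n - z n\<bar>\<^sup>2 * m n powr (q - 2) * \<beta> n)"
    define gl where "gl = (\<lambda>n. if n \<in> S then g n else 0)"
    define gs where "gs = (\<lambda>n. if n \<in> - S then \<bar>y n - z n\<bar>\<^sup>2 else 0)"
    have \<beta>: "0 < \<beta> n" for n
      using \<alpha> lam[of n] by (simp add: \<beta>_def)
    have S_iff: "n \<in> S \<longleftrightarrow> C1 * \<beta> n \<le> m n powr (2 - q)" for n
      using lam[of n] \<alpha> by (simp add: S_def large_indices_def \<beta>_def m_def field_simps)
    have g_nonneg: "0 \<le> g n" for n
      using \<beta>[of n] by (simp add: g_def)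
    \<comment> \<open>On the large indices the weight is at most 1 / C1, so the left-hand series of
      the noise condition converges and its \<open>infsum\<close> is not a default value.\<close>
    have gl_le: "\<bar>gl n\<bar> \<le> 1 / C1 * (z n - y n)\<^sup>2" for n
    proof (cases "n \<in> S")
      case True
      then have le: "C1 * \<beta> n \<le> m n powr (2 - q)"
        by (simp add: S_iff)
      have m: "0 < m n"
      proof -
        have "0 < C1 * \<beta> n"
          using C1 \<beta>[of n] by simp
        then have "m n \<noteq> 0"
          using le by auto
        moreover have "0 \<le> m n"
          by (simp add: m_def data_max_def)
        ultimately show ?thesis by simp
      qed
      have "m n powr (q - 2) * (C1 * \<beta> n) \<le> m n powr (q - 2) * m n powr (2 - q)"
        using le by (intro mult_left_mono) auto
      also have "\<dots> = 1"
        using m by (simp flip: powr_add)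
      finally have "m n powr (q - 2) * \<beta> n \<le> 1 / C1"
        using C1 by (simp add: field_simps)
      then have "(z n - y n)\<^sup>2 * (m n powr (q - 2) * \<beta> n) \<le> (z n - y n)\<^sup>2 * (1 / C1)"
        by (intro mult_left_mono) auto
      then show ?thesis
        using True g_nonneg[of n] by (simp add: gl_def g_def mult_ac power2_commute)
    qed (use C1 in \<open>simp add: gl_def\<close>)
    have sgl': "summable (\<lambda>n. \<bar>gl n\<bar>)"
      by (rule summable_comparison_test'[OF summable_mult[OF se, of "1 / C1"], of 0])
        (use gl_le in simp)
    have sgs': "summable (\<lambda>n. \<bar>gs n\<bar>)"
      by (rule summable_comparison_test'[OF se, of 0]) (simp add: gs_def power2_commute)
    have sgl: "summable gl" and sgs: "summable gs"
      using sgl' sgs' by (auto intro: summable_rabs_cancel)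
    have "infsum g S \<le> C2 * infsum (\<lambda>n. \<bar>y n - z n\<bar>\<^sup>2) (- S)"
      using noise unfolding noise_condition_def g_def S_def m_def \<beta>_def .
    moreover have "infsum g S = suminf gl"
      using sgl' unfolding gl_def by (rule infsum_eq_suminf_indicator)
    moreover have "infsum (\<lambda>n. \<bar>y n - z n\<bar>\<^sup>2) (- S) = suminf gs"
      using sgs' unfolding gs_def by (rule infsum_eq_suminf_indicator)
    ultimately have gl_gs: "suminf gl \<le> C2 * suminf gs"
      by simp
    \<comment> \<open>The scalar lemmas are applied with t = z - p and t0 = y - p0, whose residuals
      are p and p0.\<close>
    have p': "\<beta> n * signed_powr (q - 1) (z n - p n) = p n"
      and p0': "\<beta> n * signed_powr (q - 1) (y n - p0 n) = p0 n" for n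
      using p[of n] p0[of n] by (simp_all add: \<beta>_def)
    have gs_le: "gs n \<le> L * ((p n)\<^sup>2 + (p0 n)\<^sup>2)" for n
    proof (cases "n \<in> S")
      case False
      then have "(z n - y n)\<^sup>2 \<le> L * ((p n)\<^sup>2 + (p0 n)\<^sup>2)"
        using small[OF \<beta>[of n], where y = "y n" and z = "z n" and t = "z n - p n" and ?t0.0 = "y n - p0 n"]
        by (simp add: p' p0' S_iff m_def data_max_def)
      with False show ?thesis
        by (simp add: gs_def power2_commute)
    qed (use L in \<open>simp add: gs_def\<close>)
    have term_le: "\<bar>p n - p0 n\<bar> * \<bar>z n - y n\<bar> \<le> K * gl n + gs n" for n
    proof (cases "n \<in> S")
      case True
      then have "\<bar>p n - p0 n\<bar> \<le> K * (\<beta> n * m n powr (q - 2) * \<bar>z n - y n\<bar>)"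
        using large[OF \<beta>[of n], where y = "y n" and z = "z n" and t = "z n - p n" and ?t0.0 = "y n - p0 n"]
        by (simp add: p' p0' S_iff m_def data_max_def)
      then have "\<bar>p n - p0 n\<bar> * \<bar>z n - y n\<bar>
          \<le> K * (\<beta> n * m n powr (q - 2) * \<bar>z n - y n\<bar>) * \<bar>z n - y n\<bar>"
        by (intro mult_right_mono) auto
      also have "\<dots> = K * (\<beta> n * m n powr (q - 2) * (\<bar>z n - y n\<bar> * \<bar>z n - y n\<bar>))"
        by (simp only: mult.assoc)
      also have "\<dots> = K * g n"
        by (simp add: g_def mult_ac power2_commute flip: power2_eq_square)
      finally show ?thesis
        using True by (simp add: gl_def gs_def)
    next
      case False
      have "\<bar>p n - p0 n\<bar> \<le> \<bar>z n - y n\<bar>"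
        using scalar_residual_nonexpansive(2)[of "q - 1" "\<beta> n" "z n - p n" "z n" "y n - p0 n" "y n"]
          q \<beta>[of n] by (simp add: p' p0')
      then have "\<bar>p n - p0 n\<bar> * \<bar>z n - y n\<bar> \<le> \<bar>z n - y n\<bar> * \<bar>z n - y n\<bar>"
        by (intro mult_right_mono) auto
      then show ?thesis
        using False by (simp add: gl_def gs_def power2_commute flip: power2_eq_square)
    qed
    have sum_bound: "summable (\<lambda>n. K * gl n + gs n)"
      by (intro summable_add summable_mult sgl sgs)
    have sd: "summable (\<lambda>n. \<bar>p n - p0 n\<bar> * \<bar>z n - y n\<bar>)"
      by (rule summable_comparison_test'[OF sum_bound, of 0])
        (use term_le in \<open>simp add: abs_mult\<close>)
    have "(\<Sum>n. \<bar>p n - p0 n\<bar> * \<bar>z n - y n\<bar>) \<le> (\<Sum>n. K * gl n + gs n)"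
      by (rule suminf_le[OF term_le sd sum_bound])
    \<comment> \<open>The noise condition now absorbs the large part into the small one, which
      produces the factor K C2 + 1.\<close>
    also have "\<dots> = K * suminf gl + suminf gs"
      by (simp add: suminf_add[symmetric] summable_mult sgl sgs suminf_mult)
    also have "\<dots> \<le> K * (C2 * suminf gs) + suminf gs"
      using K gl_gs by (intro add_mono mult_left_mono) auto
    also have "\<dots> = (K * C2 + 1) * suminf gs"
      by (simp add: algebra_simps)
    also have "suminf gs \<le> (\<Sum>n. L * ((p n)\<^sup>2 + (p0 n)\<^sup>2))"
      by (intro suminf_le gs_le sgs summable_mult summable_add sp sp0)
    also have "\<dots> = L * ((\<Sum>n. (p n)\<^sup>2) + (\<Sum>n. (p0 n)\<^sup>2))"
      by (simp add: suminf_mult summable_add sp sp0 suminf_add)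
    finally have "(\<Sum>n. \<bar>p n - p0 n\<bar> * \<bar>z n - y n\<bar>)
        \<le> (K * C2 + 1) * (L * ((\<Sum>n. (p n)\<^sup>2) + (\<Sum>n. (p0 n)\<^sup>2)))"
      using K C2 by (simp add: mult_left_mono)
    with sd show "summable (\<lambda>n. \<bar>p n - p0 n\<bar> * \<bar>z n - y n\<bar>) \<and>
       (\<Sum>n. \<bar>p n - p0 n\<bar> * \<bar>z n - y n\<bar>)
         \<le> (K * C2 + 1) * L * ((\<Sum>n. (p n)\<^sup>2) + (\<Sum>n. (p0 n)\<^sup>2))"
      by (simp add: mult.assoc)
  qed
qed

section \<open>The diagonal operator on the sequence spaces\<close>

lemma sums_fun_upd:
  fixes f :: "nat \<Rightarrow> real"
  assumes "summable f"
  shows "(f(n := v)) sums (suminf f - f n + v)"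
proof -
  have "(\<lambda>k. f k + (if k = n then v - f n else 0)) sums (suminf f + (v - f n))"
    by (intro sums_add summable_sums assms sums_single)
  moreover have "(\<lambda>k. f k + (if k = n then v - f n else 0)) = f(n := v)"
    by auto
  ultimately show ?thesis
    by (simp only: diff_add_eq add_diff_eq)
qed

lemma summable_mult_l2:
  fixes u v :: "nat \<Rightarrow> real"
  assumes "summable (\<lambda>n. (u n)\<^sup>2)" "summable (\<lambda>n. (v n)\<^sup>2)"
  shows "summable (\<lambda>n. u n * v n)"
proof (rule summable_comparison_test'[of "\<lambda>n. (u n)\<^sup>2 + (v n)\<^sup>2" 0])
  show "summable (\<lambda>n. (u n)\<^sup>2 + (v n)\<^sup>2)"
    by (intro summable_add assms)
  show "norm (u n * v n) \<le> (u n)\<^sup>2 + (v n)\<^sup>2" for n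
  proof -
    have "2 * (\<bar>u n\<bar> * \<bar>v n\<bar>) \<le> (u n)\<^sup>2 + (v n)\<^sup>2"
      using sum_squares_bound[of "\<bar>u n\<bar>" "\<bar>v n\<bar>"] by simp
    moreover have "0 \<le> \<bar>u n\<bar> * \<bar>v n\<bar>"
      by simp
    ultimately have "\<bar>u n\<bar> * \<bar>v n\<bar> \<le> (u n)\<^sup>2 + (v n)\<^sup>2"
      by linarith
    then show ?thesis
      by (simp add: abs_mult)
  qed
qed

lemma summable_diff_square:
  fixes u v :: "nat \<Rightarrow> real"
  assumes "summable (\<lambda>n. (u n)\<^sup>2)" "summable (\<lambda>n. (v n)\<^sup>2)"
  shows "summable (\<lambda>n. (u n - v n)\<^sup>2)"
  unfolding power2_diff using summable_mult[OF summable_mult_l2[OF assms], of 2]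
  by (intro summable_diff summable_add assms) (simp add: mult.assoc)

lemma lp_2_iff: "u \<in> lp 2 \<longleftrightarrow> summable (\<lambda>n. (u n)\<^sup>2)"
  by (simp add: lp_def powr_numeral)

lemma lp_norm_2_square:
  assumes "summable (\<lambda>n. (u n)\<^sup>2)"
  shows "(lp_norm 2 u)\<^sup>2 = (\<Sum>n. (u n)\<^sup>2)"
  using suminf_nonneg[OF assms] by (simp add: lp_norm_def powr_numeral powr_half_sqrt)

lemma lq_penalty_eq:
  assumes "0 < q" "x \<in> lp q"
  shows "lq_penalty q x = (\<Sum>n. \<bar>x n\<bar> powr q) / q"
proof -
  have "0 \<le> (\<Sum>n. \<bar>x n\<bar> powr q)"
    using assms by (intro suminf_nonneg) (auto simp: lp_def)
  then show ?thesis
    using assms by (simp add: lq_penalty_def lp_norm_def powr_powr)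
qed

lemma lp_fun_upd_sums:
  assumes "x \<in> lp q"
  shows "(\<lambda>k. \<bar>(x(n := v)) k\<bar> powr q) sums ((\<Sum>k. \<bar>x k\<bar> powr q) - \<bar>x n\<bar> powr q + \<bar>v\<bar> powr q)"
proof -
  have "(\<lambda>k. \<bar>(x(n := v)) k\<bar> powr q) = (\<lambda>k. \<bar>x k\<bar> powr q)(n := \<bar>v\<bar> powr q)"
    by auto
  moreover have "summable (\<lambda>k. \<bar>x k\<bar> powr q)"
    using assms by (simp add: lp_def)
  note sums_fun_upd[OF this, of n "\<bar>v\<bar> powr q"]
  ultimately show ?thesis
    by (simp only:)
qed

lemma lp_fun_upd: "x \<in> lp q \<Longrightarrow> x(n := v) \<in> lp q"
  using lp_fun_upd_sums[of x q n v] unfolding lp_def by (auto dest: sums_summable)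

lemma lq_penalty_fun_upd:
  assumes "0 < q" "x \<in> lp q"
  shows "lq_penalty q (x(n := v)) = lq_penalty q x - \<bar>x n\<bar> powr q / q + \<bar>v\<bar> powr q / q"
  unfolding lq_penalty_eq[OF assms(1) lp_fun_upd[OF assms(2)]] lq_penalty_eq[OF assms]
    sums_unique[OF lp_fun_upd_sums[OF assms(2), of n v], symmetric]
  by (simp only: diff_divide_distrib add_divide_distrib)

lemma zero_in_lp: "(\<lambda>_. 0) \<in> lp q"
  by (simp add: lp_def)

lemma lp_initial_segment: "(\<lambda>k. if k < N then x k else 0) \<in> lp q"
  unfolding lp_def by (auto intro!: summable_finite[of "{..<N}"] split: if_splits)

lemma lp_tail:
  assumes "x \<in> lp q"
  shows "(\<lambda>k. if k < N then 0 else x k) \<in> lp q"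
  using assms unfolding lp_def
  by (auto intro: summable_comparison_test'[of "\<lambda>k. \<bar>x k\<bar> powr q" 0])

lemma lp_norm_tail_tendsto_0:
  assumes "0 < q" "x \<in> lp q"
  shows "(\<lambda>N. lp_norm q (\<lambda>k. if k < N then 0 else x k)) \<longlonglongrightarrow> 0"
proof -
  have x: "summable (\<lambda>k. \<bar>x k\<bar> powr q)"
    using assms by (simp add: lp_def)
  have tail: "(\<Sum>k. \<bar>if k < N then 0 else x k\<bar> powr q)
      = (\<Sum>k. \<bar>x k\<bar> powr q) - (\<Sum>k<N. \<bar>x k\<bar> powr q)" for N
  proof -
    have "(\<lambda>k. \<bar>x k\<bar> powr q - (if k \<in> {..<N} then \<bar>x k\<bar> powr q else 0))
        sums ((\<Sum>k. \<bar>x k\<bar> powr q) - (\<Sum>k\<in>{..<N}. \<bar>x k\<bar> powr q))"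
      by (intro sums_diff summable_sums x sums_If_finite_set) auto
    moreover have "(\<lambda>k. \<bar>x k\<bar> powr q - (if k \<in> {..<N} then \<bar>x k\<bar> powr q else 0))
        = (\<lambda>k. \<bar>if k < N then 0 else x k\<bar> powr q)"
      by auto
    ultimately show ?thesis
      by (simp add: sums_iff)
  qed
  have "(\<lambda>N. (\<Sum>k. \<bar>x k\<bar> powr q) - (\<Sum>k<N. \<bar>x k\<bar> powr q)) \<longlonglongrightarrow> 0"
    using tendsto_diff[OF tendsto_const[of "\<Sum>k. \<bar>x k\<bar> powr q"] summable_LIMSEQ[OF x]] by simp
  then have "(\<lambda>N. (\<Sum>k. \<bar>if k < N then 0 else x k\<bar> powr q)) \<longlonglongrightarrow> 0"
    by (simp only: tail)
  moreover have "0 \<le> (\<Sum>k. \<bar>if k < N then 0 else x k\<bar> powr q)" for N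
    using lp_tail[OF assms(2)] by (intro suminf_nonneg) (auto simp: lp_def)
  ultimately have "(\<lambda>N. (\<Sum>k. \<bar>if k < N then 0 else x k\<bar> powr q) powr (1 / q)) \<longlonglongrightarrow> 0 powr (1 / q)"
    using assms by (intro tendsto_powr') auto
  then show ?thesis
    by (simp add: lp_norm_def)
qed

text \<open>The operator is prescribed on unit vectors only. Linearity extends the formula to
  initial segments, and boundedness makes the image of the tail vanish in the limit, coordinate by
  coordinate.\<close>

lemma diagonal_operator_apply:
  assumes q: "0 < q"
    and A: "lp_bounded_linear q 2 A"
    and diag: "\<And>n. A (unit_seq n) = (\<lambda>k. lam n * unit_seq n k)"
    and x: "x \<in> lp q"
  shows "A x = (\<lambda>n. lam n * x n)"
proof -
  have maps: "A u \<in> lp 2" if "u \<in> lp q" for u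
    using A that by (simp add: lp_bounded_linear_def)
  have add: "A (\<lambda>n. u n + v n) = (\<lambda>n. A u n + A v n)" if "u \<in> lp q" "v \<in> lp q" for u v
    using A that by (simp add: lp_bounded_linear_def)
  have scale: "A (\<lambda>n. c * u n) = (\<lambda>n. c * A u n)" if "u \<in> lp q" for c u
    using A that by (simp add: lp_bounded_linear_def)
  obtain K where K: "\<And>u. u \<in> lp q \<Longrightarrow> lp_norm 2 (A u) \<le> K * lp_norm q u"
    using A unfolding lp_bounded_linear_def by blast
  have unit: "(\<lambda>k. c * unit_seq n k) \<in> lp q" for n c
    using lp_fun_upd[OF zero_in_lp[of q], of n c]
    by (simp add: unit_seq_def fun_upd_def if_distrib cong: if_cong)
  have unit1: "unit_seq n \<in> lp q" for n
    using unit[of 1 n] by simp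
  have fin: "A (\<lambda>k. if k < N then x k else 0) = (\<lambda>k. if k < N then lam k * x k else 0)" for N
  proof (induction N)
    case 0
    show ?case
      using scale[OF zero_in_lp, of 0] by simp
  next
    case (Suc N)
    have "(\<lambda>k. if k < Suc N then x k else 0)
        = (\<lambda>k. (if k < N then x k else 0) + x N * unit_seq N k)"
      by (auto simp: unit_seq_def less_Suc_eq)
    then have "A (\<lambda>k. if k < Suc N then x k else 0)
        = (\<lambda>k. (if k < N then lam k * x k else 0) + x N * (lam N * unit_seq N k))"
      by (simp only: add[OF lp_initial_segment unit] Suc.IH scale[OF unit1] diag)
    also have "\<dots> = (\<lambda>k. if k < Suc N then lam k * x k else 0)"
      by (auto simp: unit_seq_def less_Suc_eq)
    finally show ?case .
  qed
  show ?thesis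
  proof
    fix n
    define R where "R N = (\<lambda>k. if k < N then 0 else x k)" for N
    have R: "R N \<in> lp q" for N
      using lp_tail[OF x] by (simp add: R_def)
    have "\<bar>A x n - lam n * x n\<bar> \<le> K * lp_norm q (R N)" if "n < N" for N
    proof -
      \<comment> \<open>For N > n the initial segment already contributes the full value at n, so
        the error is the n-th coordinate of the image of the tail.\<close>
      have "A x = A (\<lambda>k. (if k < N then x k else 0) + R N k)"
        by (rule arg_cong[of _ _ A]) (auto simp: R_def)
      then have "A x n = lam n * x n + A (R N) n"
        using that by (simp add: add[OF lp_initial_segment R] fin)
      moreover have "\<bar>A (R N) n\<bar> \<le> lp_norm 2 (A (R N))"
      proof -
        have s: "summable (\<lambda>k. (A (R N) k)\<^sup>2)"
          using maps[OF R] by (simp add: lp_2_iff)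
        have "(A (R N) n)\<^sup>2 \<le> (lp_norm 2 (A (R N)))\<^sup>2"
          unfolding lp_norm_2_square[OF s] using sum_le_suminf[OF s, of "{n}"] by simp
        moreover have "0 \<le> lp_norm 2 (A (R N))"
          by (simp add: lp_norm_def)
        ultimately show ?thesis
          by (simp flip: abs_le_square_iff)
      qed
      ultimately show ?thesis
        using K[OF R, of N] by simp
    qed
    then have "eventually (\<lambda>N. \<bar>A x n - lam n * x n\<bar> \<le> K * lp_norm q (R N)) sequentially"
      using eventually_gt_at_top[of n] by (rule eventually_mono[rotated])
    moreover have "(\<lambda>N. K * lp_norm q (R N)) \<longlonglongrightarrow> K * 0"
      unfolding R_def by (intro tendsto_mult tendsto_const lp_norm_tail_tendsto_0 q x)
    ultimately have "\<bar>A x n - lam n * x n\<bar> \<le> K * 0"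
      by (intro tendsto_lowerbound) auto
    then show "A x n = lam n * x n"
      by simp
  qed
qed

text \<open>Changing one coordinate of the minimiser alters one term of each series, which leaves a
  scalar minimum problem for \<open>abs_powr_stationary\<close>.\<close>

lemma tikhonov_optimality:
  assumes q: "1 < q" and \<alpha>: "0 < \<alpha>"
    and diag: "\<And>x. x \<in> lp q \<Longrightarrow> A x = (\<lambda>n. lam n * x n)"
    and res: "summable (\<lambda>n. (lam n * x n - z n)\<^sup>2)"
    and min: "is_arg_min (tikhonov q A z \<alpha>) (\<lambda>x. x \<in> lp q) x"
  shows "lam n * (z n - lam n * x n) = \<alpha> * signed_powr (q - 1) (x n)"
proof (rule abs_powr_stationary[OF q \<alpha>, of _ _ "(lam n)\<^sup>2 / 2"])
  fix h
  define x' where "x' = x(n := x n + h)"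
  have x: "x \<in> lp q" and le: "\<And>x'. x' \<in> lp q \<Longrightarrow> tikhonov q A z \<alpha> x \<le> tikhonov q A z \<alpha> x'"
    using min by (auto simp: is_arg_min_linorder)
  have x': "x' \<in> lp q"
    using x by (simp add: x'_def lp_fun_upd)
  have "(\<lambda>k. lam k * x' k - z k) = (\<lambda>k. lam k * x k - z k)(n := lam n * (x n + h) - z n)"
    by (auto simp: x'_def)
  then have "(\<lambda>k. (lam k * x' k - z k)\<^sup>2)
      = (\<lambda>k. (lam k * x k - z k)\<^sup>2)(n := (lam n * (x n + h) - z n)\<^sup>2)"
    by (auto simp: fun_eq_iff)
  with sums_fun_upd[OF res, of n "(lam n * (x n + h) - z n)\<^sup>2"]
  have sums: "(\<lambda>k. (lam k * x' k - z k)\<^sup>2) sums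
      ((\<Sum>k. (lam k * x k - z k)\<^sup>2) - (lam n * x n - z n)\<^sup>2 + (lam n * (x n + h) - z n)\<^sup>2)"
    by (simp only:)
  have "(residual_norm A x' z)\<^sup>2
      = (residual_norm A x z)\<^sup>2 - (lam n * x n - z n)\<^sup>2 + (lam n * (x n + h) - z n)\<^sup>2"
    unfolding residual_norm_def diag[OF x] diag[OF x']
    using lp_norm_2_square[OF sums_summable[OF sums]] lp_norm_2_square[OF res] sums_unique[OF sums]
    by simp
  moreover have "lq_penalty q x'
      = lq_penalty q x - \<bar>x n\<bar> powr q / q + \<bar>x n + h\<bar> powr q / q"
    unfolding x'_def using q x by (simp add: lq_penalty_fun_upd)
  ultimately have "tikhonov q A z \<alpha> x' - tikhonov q A z \<alpha> x
      = 1 / 2 * ((lam n * (x n + h) - z n)\<^sup>2 - (lam n * x n - z n)\<^sup>2)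
        + \<alpha> * (\<bar>x n + h\<bar> powr q / q - \<bar>x n\<bar> powr q / q)"
    unfolding tikhonov_def by (simp only:) (simp add: algebra_simps)
  \<comment> \<open>The data term is exactly quadratic in h; its coefficients are the a and b of
    \<open>abs_powr_stationary\<close>.\<close>
  moreover have "1 / 2 * ((lam n * (x n + h) - z n)\<^sup>2 - (lam n * x n - z n)\<^sup>2)
      = (lam n)\<^sup>2 / 2 * h\<^sup>2 - lam n * (z n - lam n * x n) * h"
    by (simp add: power2_eq_square algebra_simps)
  ultimately show "lam n * (z n - lam n * x n) * h + \<alpha> * (\<bar>x n\<bar> powr q / q)
      \<le> (lam n)\<^sup>2 / 2 * h\<^sup>2 + \<alpha> * (\<bar>x n + h\<bar> powr q / q)"
    using le[OF x'] by (simp add: right_diff_distrib)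
qed

text \<open>Testing the subgradient inequality with one-coordinate perturbations gives the scalar
  stationarity problem without a quadratic term.\<close>

lemma source_condition_components:
  assumes q: "1 < q"
    and diag: "\<And>x. x \<in> lp q \<Longrightarrow> A x = (\<lambda>n. lam n * x n)"
    and x: "x \<in> lp q"
    and sub: "l2_adjoint A w \<in> lp_subdifferential q (lq_penalty q) x"
  shows "lam n * w n = signed_powr (q - 1) (x n)"
proof -
  have "lam n * w n = 1 * signed_powr (q - 1) (x n)"
  proof (rule abs_powr_stationary[OF q, of 1 _ _ 0])
    fix h
    define x' where "x' = x(n := x n + h)"
    define u where "u = (\<lambda>k. if k = n then h else (0::real))"
    have x': "x' \<in> lp q"
      using x by (simp add: x'_def lp_fun_upd)
    have u: "u \<in> lp q"
      using lp_fun_upd[OF zero_in_lp[of q], of n h] by (simp add: u_def fun_upd_def)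
    have diff: "(\<lambda>k. x' k - x k) = u"
      by (auto simp: x'_def u_def)
    have "(\<lambda>k. w k * A u k) = (\<lambda>k. if k = n then lam n * w n * h else 0)"
      unfolding diag[OF u] by (auto simp: u_def)
    then have "l2_adjoint A w u = lam n * w n * h"
      using sums_unique[OF sums_single[of n "\<lambda>_. lam n * w n * h"]]
      by (simp add: l2_adjoint_def l2_inner_def)
    moreover have "lq_penalty q x' \<ge> lq_penalty q x + l2_adjoint A w u"
      using sub x' unfolding lp_subdifferential_def by (auto simp flip: diff)
    moreover have "lq_penalty q x' = lq_penalty q x - \<bar>x n\<bar> powr q / q + \<bar>x n + h\<bar> powr q / q"
      unfolding x'_def using q x by (simp add: lq_penalty_fun_upd)
    ultimately show "lam n * w n * h + 1 * (\<bar>x n\<bar> powr q / q)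
        \<le> 0 * h\<^sup>2 + 1 * (\<bar>x n + h\<bar> powr q / q)"
      by simp
  qed simp
  then show ?thesis by simp
qed

text \<open>Substituting t = l x uses homogeneity of degree q - 1; with the division by l this
  explains the weight \<alpha> / l^q.\<close>

lemma residual_component_eq:
  assumes "1 < q" "0 < l" "l * (z - l * x) = \<alpha> * signed_powr (q - 1) x"
  shows "z - l * x = \<alpha> / l powr q * signed_powr (q - 1) (l * x)"
proof -
  have "l powr q = l powr (q - 1) * l"
    using assms by (simp add: powr_diff)
  then have "\<alpha> / l powr q * signed_powr (q - 1) (l * x) = \<alpha> * signed_powr (q - 1) x / l"
    using assms by (simp add: signed_powr_mult_pos)
  also have "\<dots> = z - l * x"
    using assms by (simp flip: assms(3))
  finally show ?thesis by simp
qed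

text \<open>\<open>p0\<close> is built coordinatewise from the scalar equation. Since |t| \<le> |y|
  = \<lambda> |x|, the residual is at most \<alpha> |x|^(q-1) / \<lambda>, and this is \<alpha> |w|
  by the source condition.\<close>

lemma exact_residual_exists:
  fixes lam w x y :: "nat \<Rightarrow> real"
  assumes q: "1 < q" and \<alpha>: "0 < \<alpha>" and lam: "\<And>n. 0 < lam n"
    and y: "\<And>n. y n = lam n * x n"
    and w: "\<And>n. lam n * w n = signed_powr (q - 1) (x n)"
  obtains p0 where
    "\<And>n. p0 n = \<alpha> / lam n powr q * signed_powr (q - 1) (y n - p0 n)"
    "\<And>n. \<bar>p0 n\<bar> \<le> \<alpha> * \<bar>w n\<bar>"
proof -
  define \<beta> where "\<beta> n = \<alpha> / lam n powr q" for n
  have \<beta>: "0 < \<beta> n" for n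
    using \<alpha> lam[of n] by (simp add: \<beta>_def)
  have "\<exists>t. t + \<beta> n * signed_powr (q - 1) t = y n" for n
    using scalar_equation_solvable[of "q - 1" "\<beta> n" "y n"] q \<beta>[of n] by simp
  then obtain t where t: "\<And>n. t n + \<beta> n * signed_powr (q - 1) (t n) = y n"
    by metis
  show thesis
  proof (rule that[of "\<lambda>n. y n - t n"])
    fix n
    show eq: "y n - t n = \<alpha> / lam n powr q * signed_powr (q - 1) (y n - (y n - t n))"
      using t[of n] by (simp add: \<beta>_def)
    have l: "lam n powr q = lam n powr (q - 1) * lam n"
      using lam[of n] by (simp add: powr_diff)
    have "\<bar>t n\<bar> \<le> \<bar>y n\<bar>"
      using abs_scalar_equation[OF _ t[of n]] \<beta>[of n]
      by (smt (verit) mult_nonneg_nonneg powr_ge_zero)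
    then have "\<beta> n * \<bar>t n\<bar> powr (q - 1) \<le> \<beta> n * \<bar>y n\<bar> powr (q - 1)"
      using \<beta>[of n] q by (intro mult_left_mono powr_mono2) auto
    also have "\<dots> = \<alpha> * \<bar>x n\<bar> powr (q - 1) / lam n"
      using lam[of n] by (simp add: \<beta>_def y abs_mult powr_mult l)
    also have "\<dots> = \<alpha> * \<bar>w n\<bar>"
      using arg_cong[OF w[of n], of abs] lam[of n] by (simp add: abs_mult abs_signed_powr field_simps)
    finally show "\<bar>y n - t n\<bar> \<le> \<alpha> * \<bar>w n\<bar>"
      using eq \<alpha> by (simp add: abs_mult abs_signed_powr \<beta>_def)
  qed
qed

section \<open>The Bregman distance\<close>

lemma sum_squares_nonexpansive:
  fixes u v e :: "nat \<Rightarrow> real"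
  assumes "summable (\<lambda>n. (u n)\<^sup>2)" "summable (\<lambda>n. (v n)\<^sup>2)" "summable (\<lambda>n. (e n)\<^sup>2)"
    and le: "\<And>n. \<bar>u n - v n\<bar> \<le> \<bar>e n\<bar>"
  shows "(\<Sum>n. (u n)\<^sup>2) \<le> 2 * (\<Sum>n. (v n)\<^sup>2) + 2 * (\<Sum>n. (e n)\<^sup>2)"
proof -
  have "(u n)\<^sup>2 \<le> 2 * (v n)\<^sup>2 + 2 * (e n)\<^sup>2" for n
  proof -
    have "(u n - v n)\<^sup>2 \<le> (e n)\<^sup>2"
      using le[of n] by (simp only: abs_le_square_iff)
    \<comment> \<open>The difference of the two sides is the square of u - 2 v.\<close>
    moreover have "(u n)\<^sup>2 \<le> 2 * (v n)\<^sup>2 + 2 * (u n - v n)\<^sup>2"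
      using zero_le_power2[of "u n - 2 * v n"] by (simp add: power2_eq_square algebra_simps)
    ultimately show ?thesis
      by linarith
  qed
  then have "(\<Sum>n. (u n)\<^sup>2) \<le> (\<Sum>n. 2 * (v n)\<^sup>2 + 2 * (e n)\<^sup>2)"
    using assms by (intro suminf_le summable_add summable_mult)
  also have "\<dots> = 2 * (\<Sum>n. (v n)\<^sup>2) + 2 * (\<Sum>n. (e n)\<^sup>2)"
    using assms by (simp add: suminf_add[symmetric] suminf_mult summable_mult)
  finally show ?thesis .
qed

text \<open>A termwise estimate, summed at the end. The products with w are split by Young's
  inequality with free weights \<open>\<delta>\<close> and \<open>r\<close>, so that only series of
  squares remain next to the mixed term.\<close>

lemma bregman_distance_bound:
  fixes w x xdag y z p p0 lam :: "nat \<Rightarrow> real"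
  assumes q: "1 < q" and \<alpha>: "0 < \<alpha>" and lam: "\<And>n. 0 < lam n"
    and diag: "\<And>x. x \<in> lp q \<Longrightarrow> A x = (\<lambda>n. lam n * x n)"
    and x: "x \<in> lp q" and xdag: "xdag \<in> lp q"
    and y: "\<And>n. y n = lam n * xdag n"
    and p: "\<And>n. p n = z n - lam n * x n"
    and opt: "\<And>n. lam n * p n = \<alpha> * signed_powr (q - 1) (x n)"
    and p0: "\<And>n. \<bar>p0 n\<bar> \<le> \<alpha> * \<bar>w n\<bar>"
    and sw: "summable (\<lambda>n. (w n)\<^sup>2)" and sp: "summable (\<lambda>n. (p n)\<^sup>2)"
    and se: "summable (\<lambda>n. (z n - y n)\<^sup>2)"
    and sd: "summable (\<lambda>n. \<bar>p n - p0 n\<bar> * \<bar>z n - y n\<bar>)"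
    and \<delta>: "0 < \<delta>" and r: "0 < r"
  shows "bregman_distance (lq_penalty q) (l2_adjoint A w) x xdag
    \<le> (\<Sum>n. \<bar>p n - p0 n\<bar> * \<bar>z n - y n\<bar>) / \<alpha>
      + (\<delta> * (\<Sum>n. (w n)\<^sup>2) + (\<Sum>n. (z n - y n)\<^sup>2) / \<delta>)
      + (r * (\<Sum>n. (w n)\<^sup>2) + (\<Sum>n. (p n)\<^sup>2) / r) / 2"
proof -
  define b where "b n = \<bar>x n\<bar> powr q / q - \<bar>xdag n\<bar> powr q / q - w n * (lam n * (x n - xdag n))"
    for n
  define B where "B n = \<bar>p n - p0 n\<bar> * \<bar>z n - y n\<bar> / \<alpha>
      + (\<delta> * (w n)\<^sup>2 + (z n - y n)\<^sup>2 / \<delta>) + (r * (w n)\<^sup>2 + (p n)\<^sup>2 / r) / 2" for n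
  have sx: "summable (\<lambda>n. \<bar>x n\<bar> powr q)" and sxd: "summable (\<lambda>n. \<bar>xdag n\<bar> powr q)"
    using x xdag by (auto simp: lp_def)
  have diff: "lam n * (x n - xdag n) = (z n - y n) - p n" for n
    by (simp add: p y right_diff_distrib)
  have sA: "summable (\<lambda>n. w n * (lam n * (x n - xdag n)))"
    unfolding diff by (intro summable_mult_l2 sw summable_diff_square se sp)
  have young: "2 * (\<bar>a\<bar> * \<bar>b\<bar>) \<le> t * a\<^sup>2 + b\<^sup>2 / t" if "0 < t" for a b t :: real
  proof -
    have "0 \<le> (t * \<bar>a\<bar> - \<bar>b\<bar>)\<^sup>2 / t"
      using that by simp
    also have "\<dots> = t * a\<^sup>2 - 2 * (\<bar>a\<bar> * \<bar>b\<bar>) + b\<^sup>2 / t"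
      using that by (simp add: power2_diff power_mult_distrib add_divide_distrib diff_divide_distrib)
        (simp add: power2_eq_square)
    finally show ?thesis by simp
  qed
  have b_le: "b n \<le> B n" for n
  proof -
    define e where "e = z n - y n"
    \<comment> \<open>Convexity at the regularised solution, so that its optimality condition
      replaces the subgradient by \<lambda> p / \<alpha>.\<close>
    have "\<bar>x n\<bar> powr q / q - \<bar>xdag n\<bar> powr q / q \<le> signed_powr (q - 1) (x n) * (x n - xdag n)"
      using abs_powr_subgradient[OF q, of "x n" "xdag n"] by (simp add: algebra_simps)
    also have "\<dots> = lam n * p n / \<alpha> * (x n - xdag n)"
      using \<alpha> by (simp add: opt)
    also have "\<dots> = p n * (lam n * (x n - xdag n)) / \<alpha>"
      by simp
    also have "\<dots> = p n * (e - p n) / \<alpha>"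
      by (simp add: diff e_def)
    finally have b: "b n \<le> p n * (e - p n) / \<alpha> - w n * (e - p n)"
      by (simp add: b_def diff e_def)
    \<comment> \<open>Inserting p0 separates a part controlled by the noise condition from one
      controlled by |p0| \<le> \<alpha> |w|; the square of p has a favourable sign and is
      dropped.\<close>
    have "p n * (e - p n) = (p n - p0 n) * e + p0 n * e - (p n)\<^sup>2"
      by (simp add: power2_eq_square algebra_simps)
    also have "\<dots> / \<alpha> \<le> (\<bar>p n - p0 n\<bar> * \<bar>e\<bar> + \<alpha> * \<bar>w n\<bar> * \<bar>e\<bar>) / \<alpha>"
    proof (intro divide_right_mono)
      have "(p n - p0 n) * e \<le> \<bar>p n - p0 n\<bar> * \<bar>e\<bar>"
        by (metis abs_ge_self abs_mult)
      moreover have "p0 n * e \<le> \<bar>p0 n\<bar> * \<bar>e\<bar>"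
        by (metis abs_ge_self abs_mult)
      moreover have "\<bar>p0 n\<bar> * \<bar>e\<bar> \<le> \<alpha> * \<bar>w n\<bar> * \<bar>e\<bar>"
        using p0 by (intro mult_right_mono) auto
      moreover have "0 \<le> (p n)\<^sup>2"
        by simp
      ultimately show "(p n - p0 n) * e + p0 n * e - (p n)\<^sup>2
          \<le> \<bar>p n - p0 n\<bar> * \<bar>e\<bar> + \<alpha> * \<bar>w n\<bar> * \<bar>e\<bar>"
        by linarith
    qed (use \<alpha> in auto)
    also have "\<dots> = \<bar>p n - p0 n\<bar> * \<bar>e\<bar> / \<alpha> + \<bar>w n\<bar> * \<bar>e\<bar>"
      using \<alpha> by (simp add: add_divide_distrib)
    finally have pe: "p n * (e - p n) / \<alpha> \<le> \<bar>p n - p0 n\<bar> * \<bar>e\<bar> / \<alpha> + \<bar>w n\<bar> * \<bar>e\<bar>" .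
    have we: "- (w n * (e - p n)) \<le> \<bar>w n\<bar> * \<bar>e\<bar> + \<bar>w n\<bar> * \<bar>p n\<bar>"
    proof -
      have "w n * p n \<le> \<bar>w n\<bar> * \<bar>p n\<bar>"
        by (metis abs_ge_self abs_mult)
      moreover have "- (w n * e) \<le> \<bar>w n\<bar> * \<bar>e\<bar>"
        by (metis abs_ge_minus_self abs_mult)
      ultimately show ?thesis
        by (simp add: right_diff_distrib)
    qed
    have "b n \<le> \<bar>p n - p0 n\<bar> * \<bar>e\<bar> / \<alpha> + 2 * (\<bar>w n\<bar> * \<bar>e\<bar>) + \<bar>w n\<bar> * \<bar>p n\<bar>"
      using b pe we by linarith
    also have "\<dots> \<le> B n"
    proof -
      \<comment> \<open>|w| |e| occurs twice, as Young's inequality provides it, whereas |w| |p|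
        occurs once; hence the division by 2.\<close>
      have half: "s \<le> t / 2" if "2 * s \<le> t" for s t :: real
        using that by simp
      show ?thesis
        unfolding B_def e_def by (intro add_mono order_refl half young \<delta> r)
    qed
    finally show ?thesis .
  qed
  have "(\<lambda>n. b n) sums ((\<Sum>n. \<bar>x n\<bar> powr q) / q - (\<Sum>n. \<bar>xdag n\<bar> powr q) / q
      - (\<Sum>n. w n * (lam n * (x n - xdag n))))"
    unfolding b_def by (intro sums_diff sums_divide summable_sums sx sxd sA)
  \<comment> \<open>The diagonal formula is available on \<open>lp q\<close> only, so the difference
    has to be placed there first.\<close>
  moreover have "(\<lambda>n. x n - xdag n) \<in> lp q"
  proof -
    have bound: "\<bar>x n - xdag n\<bar> powr q \<le> 2 powr q * (\<bar>x n\<bar> powr q + \<bar>xdag n\<bar> powr q)" for n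
    proof -
      have "\<bar>x n - xdag n\<bar> powr q \<le> (2 * max \<bar>x n\<bar> \<bar>xdag n\<bar>) powr q"
        using q by (intro powr_mono2) auto
      also have "\<dots> = 2 powr q * max \<bar>x n\<bar> \<bar>xdag n\<bar> powr q"
        by (simp add: powr_mult)
      also have "\<dots> \<le> 2 powr q * (\<bar>x n\<bar> powr q + \<bar>xdag n\<bar> powr q)"
        by (intro mult_left_mono) (auto simp: max_def)
      finally show ?thesis .
    qed
    show ?thesis
      unfolding lp_def mem_Collect_eq
      by (rule summable_comparison_test'[OF summable_mult[OF summable_add[OF sx sxd], of "2 powr q"], of 0])
        (use bound in simp)
  qed
  then have "l2_adjoint A w (\<lambda>n. x n - xdag n) = (\<Sum>n. w n * (lam n * (x n - xdag n)))"
    by (simp add: l2_adjoint_def l2_inner_def diag)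
  ultimately have "b sums bregman_distance (lq_penalty q) (l2_adjoint A w) x xdag"
    using q x xdag by (simp add: bregman_distance_def lq_penalty_eq)
  moreover have "B sums ((\<Sum>n. \<bar>p n - p0 n\<bar> * \<bar>z n - y n\<bar>) / \<alpha>
      + (\<delta> * (\<Sum>n. (w n)\<^sup>2) + (\<Sum>n. (z n - y n)\<^sup>2) / \<delta>)
      + (r * (\<Sum>n. (w n)\<^sup>2) + (\<Sum>n. (p n)\<^sup>2) / r) / 2)"
    unfolding B_def
    by (intro sums_add sums_divide sums_mult summable_sums sd sw se sp)
  ultimately show ?thesis
    by (rule sums_le[OF b_le])
qed

section \<open>Convergence under the heuristic discrepancy rule\<close>

theorem theorem6:
  fixes q \<alpha>max :: real
    and lam :: "nat \<Rightarrow> real"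
    and A :: "(nat \<Rightarrow> real) \<Rightarrow> (nat \<Rightarrow> real)"
    and y xdag w :: "nat \<Rightarrow> real"
    and y\<delta> :: "real \<Rightarrow> nat \<Rightarrow> real"
    and x\<delta> :: "real \<Rightarrow> real \<Rightarrow> nat \<Rightarrow> real"
    and \<alpha>star :: "real \<Rightarrow> real"
    and \<xi> :: "(nat \<Rightarrow> real) \<Rightarrow> real"
  assumes q: "1 < q"
    and lam_pos: "\<And>n. 0 < lam n"
    and lam_decreasing: "decseq lam"
    and lam_null: "lam \<longlonglongrightarrow> 0"
    and A_bounded_linear: "lp_bounded_linear q 2 A"
    and A_diagonal: "\<And>n. A (unit_seq n) = (\<lambda>k. lam n * unit_seq n k)"
    and \<alpha>max: "0 < \<alpha>max"
    and y: "y \<in> lp 2"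
    and xdag: "is_arg_min (lq_penalty q) (\<lambda>x. x \<in> lp q \<and> A x = y) xdag"
    and w: "w \<in> lp 2"
    and \<xi>: "\<xi> = l2_adjoint A w"
    and source_condition: "\<xi> \<in> lp_subdifferential q (lq_penalty q) xdag"
    and y\<delta>: "\<And>\<delta>. 0 < \<delta> \<Longrightarrow> y\<delta> \<delta> \<in> lp 2"
    and noise_level: "\<And>\<delta>. 0 < \<delta> \<Longrightarrow> lp_norm 2 (\<lambda>n. y\<delta> \<delta> n - y n) \<le> \<delta>"
    and x\<delta>: "\<And>\<delta> \<alpha>. 0 < \<delta> \<Longrightarrow> \<alpha> \<in> {0<..<\<alpha>max} \<Longrightarrow>
      is_arg_min (tikhonov q A (y\<delta> \<delta>) \<alpha>) (\<lambda>x. x \<in> lp q) (x\<delta> \<delta> \<alpha>)"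
    and \<alpha>star: "\<And>\<delta>. 0 < \<delta> \<Longrightarrow>
      is_arg_min (\<lambda>\<alpha>. 1 / \<alpha> * (residual_norm A (x\<delta> \<delta> \<alpha>) (y\<delta> \<delta>))\<^sup>2)
        (\<lambda>\<alpha>. \<alpha> \<in> {0<..<\<alpha>max}) (\<alpha>star \<delta>)"
    and \<delta>star: "\<And>\<delta>. 0 < \<delta> \<Longrightarrow> residual_norm A (x\<delta> \<delta> (\<alpha>star \<delta>)) (y\<delta> \<delta>) \<noteq> 0"
    and noise: "\<exists>C1>0. \<exists>C2>0. \<forall>\<delta>>0. \<forall>\<alpha>\<in>{0<..<\<alpha>max}.
      noise_condition q lam y (y\<delta> \<delta>) \<alpha> C1 C2"
  shows "((\<lambda>\<delta>. bregman_distance (lq_penalty q) \<xi> (x\<delta> \<delta> (\<alpha>star \<delta>)) xdag) \<longlongrightarrow> 0) (at_right 0)"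
proof -
  obtain C1 C2 where C: "0 < C1" "0 < C2"
    and nc: "\<And>\<delta> \<alpha>. 0 < \<delta> \<Longrightarrow> \<alpha> \<in> {0<..<\<alpha>max} \<Longrightarrow> noise_condition q lam y (y\<delta> \<delta>) \<alpha> C1 C2"
    using noise by auto
  obtain B where B: "0 \<le> B"
    and B_bound: "\<And>lam \<alpha> y z p p0. \<lbrakk>\<And>n. 0 < lam n; 0 < \<alpha>;
       summable (\<lambda>n. (z n - y n)\<^sup>2); summable (\<lambda>n. (p n)\<^sup>2); summable (\<lambda>n. (p0 n)\<^sup>2);
       \<And>n. p n = \<alpha> / lam n powr q * signed_powr (q - 1) (z n - p n);
       \<And>n. p0 n = \<alpha> / lam n powr q * signed_powr (q - 1) (y n - p0 n);
       noise_condition q lam y z \<alpha> C1 C2\<rbrakk> \<Longrightarrow>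
       summable (\<lambda>n. \<bar>p n - p0 n\<bar> * \<bar>z n - y n\<bar>) \<and>
       (\<Sum>n. \<bar>p n - p0 n\<bar> * \<bar>z n - y n\<bar>) \<le> B * ((\<Sum>n. (p n)\<^sup>2) + (\<Sum>n. (p0 n)\<^sup>2))"
  proof (rule noise_condition_residual_bound[OF q C])
    fix B
    assume "0 \<le> B" and bound: "\<And>lam \<alpha> y z p p0. \<lbrakk>\<And>n. 0 < lam n; 0 < \<alpha>;
       summable (\<lambda>n. (z n - y n)\<^sup>2); summable (\<lambda>n. (p n)\<^sup>2); summable (\<lambda>n. (p0 n)\<^sup>2);
       \<And>n. p n = \<alpha> / lam n powr q * signed_powr (q - 1) (z n - p n);
       \<And>n. p0 n = \<alpha> / lam n powr q * signed_powr (q - 1) (y n - p0 n);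
       noise_condition q lam y z \<alpha> C1 C2\<rbrakk> \<Longrightarrow>
       summable (\<lambda>n. \<bar>p n - p0 n\<bar> * \<bar>z n - y n\<bar>) \<and>
       (\<Sum>n. \<bar>p n - p0 n\<bar> * \<bar>z n - y n\<bar>) \<le> B * ((\<Sum>n. (p n)\<^sup>2) + (\<Sum>n. (p0 n)\<^sup>2))"
    show thesis
      by (rule that[OF \<open>0 \<le> B\<close>], rule bound)
  qed
  have diag: "A x = (\<lambda>n. lam n * x n)" if "x \<in> lp q" for x
    using diagonal_operator_apply[OF _ A_bounded_linear A_diagonal that] q by simp
  have maps: "A x \<in> lp 2" if "x \<in> lp q" for x
    using A_bounded_linear that by (simp add: lp_bounded_linear_def)
  have xdag_lp: "xdag \<in> lp q" and Axdag: "A xdag = y"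
    using xdag by (auto simp: is_arg_min_def)
  have y_eq: "y n = lam n * xdag n" for n
    using Axdag diag[OF xdag_lp] by auto
  have w_eq: "lam n * w n = signed_powr (q - 1) (xdag n)" for n
    using source_condition_components[OF q diag xdag_lp] source_condition \<xi> by simp
  have sw: "summable (\<lambda>n. (w n)\<^sup>2)" and sy: "summable (\<lambda>n. (y n)\<^sup>2)"
    using w y by (auto simp: lp_2_iff)

  \<comment> \<open>Residuals for noisy and exact data\<close>
  define W where "W = (\<Sum>n. (w n)\<^sup>2)"
  define e where "e \<delta> n = y\<delta> \<delta> n - y n" for \<delta> n
  define p where "p \<delta> \<alpha> n = y\<delta> \<delta> n - lam n * x\<delta> \<delta> \<alpha> n" for \<delta> \<alpha> n
  define P where "P \<delta> \<alpha> = (\<Sum>n. (p \<delta> \<alpha> n)\<^sup>2)" for \<delta> \<alpha>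
  have W: "0 \<le> W"
    unfolding W_def using sw by (intro suminf_nonneg) auto
  have "\<exists>p0. (\<forall>n. p0 n = \<alpha> / lam n powr q * signed_powr (q - 1) (y n - p0 n))
      \<and> (\<forall>n. \<bar>p0 n\<bar> \<le> \<alpha> * \<bar>w n\<bar>)" if "0 < \<alpha>" for \<alpha>
    by (rule exact_residual_exists[where lam = lam and w = w and x = xdag and y = y,
          OF q that lam_pos y_eq w_eq]) blast
  then obtain p0 where
    p0: "\<And>\<alpha> n. 0 < \<alpha> \<Longrightarrow> p0 \<alpha> n = \<alpha> / lam n powr q * signed_powr (q - 1) (y n - p0 \<alpha> n)"
    and p0_le: "\<And>\<alpha> n. 0 < \<alpha> \<Longrightarrow> \<bar>p0 \<alpha> n\<bar> \<le> \<alpha> * \<bar>w n\<bar>"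
    by metis
  define P0 where "P0 \<alpha> = (\<Sum>n. (p0 \<alpha> n)\<^sup>2)" for \<alpha>
  have p0_sq: "(p0 \<alpha> n)\<^sup>2 \<le> \<alpha>\<^sup>2 * (w n)\<^sup>2" if "0 < \<alpha>" for \<alpha> n
    using power_mono[OF p0_le[OF that, of n], of 2] by (simp add: power_mult_distrib)
  have sp0: "summable (\<lambda>n. (p0 \<alpha> n)\<^sup>2)" if "0 < \<alpha>" for \<alpha>
    by (rule summable_comparison_test'[OF summable_mult[OF sw, of "\<alpha>\<^sup>2"], of 0])
      (use p0_sq[OF that] in simp)
  have P0_le: "P0 \<alpha> \<le> \<alpha>\<^sup>2 * W" if "0 < \<alpha>" for \<alpha>
    unfolding P0_def W_def suminf_mult[OF sw, symmetric]
    by (intro suminf_le p0_sq sp0 summable_mult sw that)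
  have se: "summable (\<lambda>n. (e \<delta> n)\<^sup>2)" if "0 < \<delta>" for \<delta>
    unfolding e_def using y\<delta>[OF that] by (intro summable_diff_square sy) (simp add: lp_2_iff)
  have E_le: "(\<Sum>n. (e \<delta> n)\<^sup>2) \<le> \<delta>\<^sup>2" if "0 < \<delta>" for \<delta>
  proof -
    have "(lp_norm 2 (e \<delta>))\<^sup>2 \<le> \<delta>\<^sup>2"
      using noise_level[OF that] unfolding e_def by (intro power_mono) (auto simp: lp_norm_def)
    then show ?thesis
      by (simp add: lp_norm_2_square[OF se[OF that]])
  qed
  have residual: "x\<delta> \<delta> \<alpha> \<in> lp q" "summable (\<lambda>n. (p \<delta> \<alpha> n)\<^sup>2)"
      "(residual_norm A (x\<delta> \<delta> \<alpha>) (y\<delta> \<delta>))\<^sup>2 = P \<delta> \<alpha>"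
      "lam n * p \<delta> \<alpha> n = \<alpha> * signed_powr (q - 1) (x\<delta> \<delta> \<alpha> n)"
      "p \<delta> \<alpha> n = \<alpha> / lam n powr q * signed_powr (q - 1) (y\<delta> \<delta> n - p \<delta> \<alpha> n)"
      "\<bar>p \<delta> \<alpha> n - p0 \<alpha> n\<bar> \<le> \<bar>e \<delta> n\<bar>"
    if "0 < \<delta>" "\<alpha> \<in> {0<..<\<alpha>max}" for \<delta> \<alpha> n
  proof -
    have \<alpha>: "0 < \<alpha>"
      using that by simp
    show x: "x\<delta> \<delta> \<alpha> \<in> lp q"
      using x\<delta>[OF that] by (simp add: is_arg_min_def)
    have sx: "summable (\<lambda>n. (lam n * x\<delta> \<delta> \<alpha> n)\<^sup>2)"
      using maps[OF x] by (simp add: diag[OF x] lp_2_iff)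
    have sz: "summable (\<lambda>n. (y\<delta> \<delta> n)\<^sup>2)"
      using y\<delta>[OF that(1)] by (simp add: lp_2_iff)
    show "summable (\<lambda>n. (p \<delta> \<alpha> n)\<^sup>2)"
      unfolding p_def by (rule summable_diff_square[OF sz sx])
    have s: "summable (\<lambda>n. (lam n * x\<delta> \<delta> \<alpha> n - y\<delta> \<delta> n)\<^sup>2)"
      by (rule summable_diff_square[OF sx sz])
    show "(residual_norm A (x\<delta> \<delta> \<alpha>) (y\<delta> \<delta>))\<^sup>2 = P \<delta> \<alpha>"
      by (simp add: residual_norm_def diag[OF x] lp_norm_2_square[OF s] P_def p_def power2_commute)
    show opt: "lam n * p \<delta> \<alpha> n = \<alpha> * signed_powr (q - 1) (x\<delta> \<delta> \<alpha> n)"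
      using tikhonov_optimality[OF q \<alpha> diag s x\<delta>[OF that]] by (simp add: p_def)
    have data_minus: "y\<delta> \<delta> n - p \<delta> \<alpha> n = lam n * x\<delta> \<delta> \<alpha> n"
      by (simp add: p_def)
    show eq: "p \<delta> \<alpha> n = \<alpha> / lam n powr q * signed_powr (q - 1) (y\<delta> \<delta> n - p \<delta> \<alpha> n)"
      unfolding data_minus
      unfolding p_def by (rule residual_component_eq[OF q lam_pos opt[unfolded p_def]])
    have "\<bar>\<alpha> / lam n powr q * signed_powr (q - 1) (y\<delta> \<delta> n - p \<delta> \<alpha> n)
        - \<alpha> / lam n powr q * signed_powr (q - 1) (y n - p0 \<alpha> n)\<bar> \<le> \<bar>y\<delta> \<delta> n - y n\<bar>"
    proof (rule scalar_residual_nonexpansive(2))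
      show "0 < q - 1" "0 \<le> \<alpha> / lam n powr q"
        using q \<alpha> by auto
      show "y\<delta> \<delta> n - p \<delta> \<alpha> n + \<alpha> / lam n powr q * signed_powr (q - 1) (y\<delta> \<delta> n - p \<delta> \<alpha> n) = y\<delta> \<delta> n"
        by (simp only: eq[symmetric] diff_add_cancel)
      show "y n - p0 \<alpha> n + \<alpha> / lam n powr q * signed_powr (q - 1) (y n - p0 \<alpha> n) = y n"
        by (simp only: p0[OF \<alpha>, of n, symmetric] diff_add_cancel)
    qed
    then show "\<bar>p \<delta> \<alpha> n - p0 \<alpha> n\<bar> \<le> \<bar>e \<delta> n\<bar>"
      by (simp only: eq[symmetric] p0[OF \<alpha>, of n, symmetric] e_def)
  qed
  \<comment> \<open>\<open>c1\<close> collects the bounds 2 (W + 1) and 4 (W + 1) + W + 2 for the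
    two scaled residual norms, times B, and W + 1 from the noise term; \<open>c2\<close> comes from
    the product of w and p with weight sqrt \<delta>.\<close>
  define c1 where "c1 = B * (6 * (W + 1) + W + 2) + W + 1"
  define c2 where "c2 = (W + \<alpha>max * (2 * (W + 1))) / 2"
  have upper: "bregman_distance (lq_penalty q) \<xi> (x\<delta> \<delta> (\<alpha>star \<delta>)) xdag \<le> c1 * \<delta> + c2 * sqrt \<delta>"
    if \<delta>: "0 < \<delta>" and \<delta>_less: "\<delta> < \<alpha>max" for \<delta>
  proof -
    define \<alpha> where "\<alpha> = \<alpha>star \<delta>"
    have \<alpha>_in: "\<alpha> \<in> {0<..<\<alpha>max}" and \<delta>_in: "\<delta> \<in> {0<..<\<alpha>max}"
      using \<alpha>star[OF \<delta>] \<delta> \<delta>_less by (auto simp: \<alpha>_def is_arg_min_def)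
    then have \<alpha>: "0 < \<alpha>" "\<alpha> < \<alpha>max"
      by auto
    note res = residual[OF \<delta> \<alpha>_in]
    note res\<delta> = residual[OF \<delta> \<delta>_in]
    \<comment> \<open>The competitor \<alpha> = \<delta> is admissible because \<delta> <
      \<open>\<alpha>max\<close>; there the source bound and the noise level both contribute order
      \<delta>^2.\<close>
    have "P \<delta> \<delta> \<le> 2 * P0 \<delta> + 2 * (\<Sum>n. (e \<delta> n)\<^sup>2)"
      unfolding P_def P0_def
      by (rule sum_squares_nonexpansive[OF res\<delta>(2) sp0[OF \<delta>] se[OF \<delta>] res\<delta>(6)])
    also have "\<dots> \<le> 2 * (\<delta>\<^sup>2 * W) + 2 * \<delta>\<^sup>2"
      using P0_le[OF \<delta>] E_le[OF \<delta>] by simp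
    finally have P\<delta>: "P \<delta> \<delta> / \<delta> \<le> 2 * \<delta> * (W + 1)"
      using \<delta> by (simp add: field_simps power2_eq_square)
    have "1 / \<alpha> * P \<delta> \<alpha> \<le> 1 / \<delta> * P \<delta> \<delta>"
      using \<alpha>star[OF \<delta>] \<delta>_in unfolding is_arg_min_linorder \<alpha>_def[symmetric]
      by (auto simp: res(3) res\<delta>(3))
    with P\<delta> have \<psi>: "P \<delta> \<alpha> / \<alpha> \<le> 2 * \<delta> * (W + 1)"
      by simp
    \<comment> \<open>The right-hand side is the sum of W \<delta>, which suffices for \<alpha>
      \<le> \<delta>, and 4 \<delta> (W + 1) + 2 \<delta>, which suffices otherwise.\<close>
    have P0: "P0 \<alpha> / \<alpha> \<le> 4 * \<delta> * (W + 1) + (W + 2) * \<delta>"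
    proof (cases "\<alpha> \<le> \<delta>")
      case True
      have "P0 \<alpha> / \<alpha> \<le> \<alpha> * W"
        using P0_le[OF \<alpha>(1)] \<alpha> by (simp add: field_simps power2_eq_square)
      also have "\<dots> \<le> W * \<delta>"
        using True W by (simp add: mult.commute mult_left_mono)
      also have "\<dots> \<le> 4 * \<delta> * (W + 1) + (W + 2) * \<delta>"
        using W \<delta> by (simp add: algebra_simps)
      finally show ?thesis .
    next
      case False
      have "P0 \<alpha> \<le> 2 * P \<delta> \<alpha> + 2 * (\<Sum>n. (e \<delta> n)\<^sup>2)"
        unfolding P_def P0_def
        by (rule sum_squares_nonexpansive[OF sp0[OF \<alpha>(1)] res(2) se[OF \<delta>]])
          (subst abs_minus_commute, rule res(6))
      also have "\<dots> \<le> 2 * P \<delta> \<alpha> + 2 * (\<alpha> * \<delta>)"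
      proof -
        have "\<delta>\<^sup>2 \<le> \<alpha> * \<delta>"
          using False \<delta> by (simp add: power2_eq_square)
        with E_le[OF \<delta>] show ?thesis
          by linarith
      qed
      finally have "P0 \<alpha> / \<alpha> \<le> (2 * P \<delta> \<alpha> + 2 * (\<alpha> * \<delta>)) / \<alpha>"
        using \<alpha> by (intro divide_right_mono) auto
      also have "\<dots> = 2 * (P \<delta> \<alpha> / \<alpha>) + 2 * \<delta>"
        using \<alpha> by (simp add: field_simps)
      also have "\<dots> \<le> 2 * (2 * \<delta> * (W + 1)) + 2 * \<delta>"
        using \<psi> by simp
      also have "\<dots> \<le> 4 * \<delta> * (W + 1) + (W + 2) * \<delta>"
        using W \<delta> by (simp add: algebra_simps)
      finally show ?thesis .
    qed
    have sums: "summable (\<lambda>n. \<bar>p \<delta> \<alpha> n - p0 \<alpha> n\<bar> * \<bar>y\<delta> \<delta> n - y n\<bar>) \<and>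
        (\<Sum>n. \<bar>p \<delta> \<alpha> n - p0 \<alpha> n\<bar> * \<bar>y\<delta> \<delta> n - y n\<bar>) \<le> B * (P \<delta> \<alpha> + P0 \<alpha>)"
      unfolding P_def P0_def
      by (rule B_bound[where lam = lam and y = y and z = "y\<delta> \<delta>" and p = "p \<delta> \<alpha>" and ?p0.0 = "p0 \<alpha>",
            OF lam_pos \<alpha>(1) se[OF \<delta>, unfolded e_def] res(2) sp0[OF \<alpha>(1)] res(5)
            p0[OF \<alpha>(1)] nc[OF \<delta> \<alpha>_in]])
    have "(\<Sum>n. \<bar>p \<delta> \<alpha> n - p0 \<alpha> n\<bar> * \<bar>y\<delta> \<delta> n - y n\<bar>) / \<alpha> \<le> B * (P \<delta> \<alpha> + P0 \<alpha>) / \<alpha>"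
      using sums \<alpha> by (intro divide_right_mono) auto
    also have "\<dots> = B * (P \<delta> \<alpha> / \<alpha> + P0 \<alpha> / \<alpha>)"
      by (simp flip: add_divide_distrib)
    also have "\<dots> \<le> B * (2 * \<delta> * (W + 1) + (4 * \<delta> * (W + 1) + (W + 2) * \<delta>))"
      by (intro mult_left_mono add_mono \<psi> P0 B)
    finally have t1: "(\<Sum>n. \<bar>p \<delta> \<alpha> n - p0 \<alpha> n\<bar> * \<bar>y\<delta> \<delta> n - y n\<bar>) / \<alpha>
        \<le> B * (6 * (W + 1) + W + 2) * \<delta>"
      by (simp add: algebra_simps)
    have "(\<Sum>n. (y\<delta> \<delta> n - y n)\<^sup>2) / \<delta> \<le> \<delta>"
      using E_le[OF \<delta>] \<delta> by (simp add: e_def divide_le_eq power2_eq_square)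
    then have t2: "\<delta> * W + (\<Sum>n. (y\<delta> \<delta> n - y n)\<^sup>2) / \<delta> \<le> (W + 1) * \<delta>"
      by (simp add: algebra_simps)
    \<comment> \<open>No lower or finer upper bound on the selected parameter is available, so it is
      replaced by \<open>\<alpha>max\<close>: P is of order \<delta>, and the weight r = sqrt
      \<delta> balances r W against P / r.\<close>
    have "P \<delta> \<alpha> \<le> 2 * \<delta> * (W + 1) * \<alpha>"
      using \<psi> \<alpha> by (simp add: pos_divide_le_eq)
    also have "\<dots> \<le> 2 * \<delta> * (W + 1) * \<alpha>max"
      using \<alpha> \<delta> W by (intro mult_left_mono) auto
    also have "\<dots> = \<alpha>max * (2 * (W + 1)) * sqrt \<delta> * sqrt \<delta>"
      using \<delta> by simp
    finally have "P \<delta> \<alpha> / sqrt \<delta> \<le> \<alpha>max * (2 * (W + 1)) * sqrt \<delta>"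
      using \<delta> by (simp add: pos_divide_le_eq)
    then have "sqrt \<delta> * W + P \<delta> \<alpha> / sqrt \<delta> \<le> (W + \<alpha>max * (2 * (W + 1))) * sqrt \<delta>"
      by (simp only: distrib_right mult.commute[of "sqrt \<delta>" W] add_left_mono)
    then have t3: "(sqrt \<delta> * W + P \<delta> \<alpha> / sqrt \<delta>) / 2 \<le> c2 * sqrt \<delta>"
      unfolding c2_def times_divide_eq_left by (rule divide_right_mono) simp
    have "bregman_distance (lq_penalty q) (l2_adjoint A w) (x\<delta> \<delta> \<alpha>) xdag
      \<le> (\<Sum>n. \<bar>p \<delta> \<alpha> n - p0 \<alpha> n\<bar> * \<bar>y\<delta> \<delta> n - y n\<bar>) / \<alpha>
        + (\<delta> * W + (\<Sum>n. (y\<delta> \<delta> n - y n)\<^sup>2) / \<delta>)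
        + (sqrt \<delta> * W + P \<delta> \<alpha> / sqrt \<delta>) / 2"
      unfolding P_def W_def
      by (rule bregman_distance_bound[where lam = lam and w = w and y = y and z = "y\<delta> \<delta>"
            and p = "p \<delta> \<alpha>" and ?p0.0 = "p0 \<alpha>" and r = "sqrt \<delta>", OF q \<alpha>(1) lam_pos diag res(1) xdag_lp y_eq p_def res(4)
            p0_le[OF \<alpha>(1)] sw res(2) se[OF \<delta>, unfolded e_def] sums[THEN conjunct1] \<delta>])
        (use \<delta> in auto)
    also have "\<dots> \<le> B * (6 * (W + 1) + W + 2) * \<delta> + (W + 1) * \<delta> + c2 * sqrt \<delta>"
      by (intro add_mono t1 t2 t3)
    also have "\<dots> = c1 * \<delta> + c2 * sqrt \<delta>"
      by (simp add: c1_def algebra_simps)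
    finally show ?thesis
      by (simp add: \<xi> \<alpha>_def)
  qed

  \<comment> \<open>Passage to the limit between 0 and the rate sqrt \<delta>\<close>
  have lower: "0 \<le> bregman_distance (lq_penalty q) \<xi> x xdag" if "x \<in> lp q" for x
    using source_condition that by (auto simp: lp_subdifferential_def bregman_distance_def)
  have small: "eventually (\<lambda>\<delta>. \<delta> \<in> {0<..<\<alpha>max}) (at_right 0)"
    using \<alpha>max by (rule eventually_at_right_real)
  show ?thesis
  proof (rule tendsto_sandwich)
    show "eventually (\<lambda>\<delta>. 0 \<le> bregman_distance (lq_penalty q) \<xi> (x\<delta> \<delta> (\<alpha>star \<delta>)) xdag) (at_right 0)"
      using small
    proof eventually_elim
      case (elim \<delta>)
      then have "\<alpha>star \<delta> \<in> {0<..<\<alpha>max}"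
        using \<alpha>star[of \<delta>] by (auto simp: is_arg_min_def)
      then show ?case
        using residual(1)[of \<delta> "\<alpha>star \<delta>"] elim by (intro lower) auto
    qed
    show "eventually (\<lambda>\<delta>. bregman_distance (lq_penalty q) \<xi> (x\<delta> \<delta> (\<alpha>star \<delta>)) xdag
        \<le> c1 * \<delta> + c2 * sqrt \<delta>) (at_right 0)"
      using small by eventually_elim (auto intro: upper)
    have "((\<lambda>\<delta>. c1 * \<delta> + c2 * sqrt \<delta>) \<longlongrightarrow> c1 * 0 + c2 * sqrt 0) (at_right 0)"
      by (intro tendsto_intros)
    then show "((\<lambda>\<delta>. c1 * \<delta> + c2 * sqrt \<delta>) \<longlongrightarrow> 0) (at_right 0)"
      by simp
  qed simp
qed

end
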